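(* Consider any spherical or Ising mixed $p$-spin model. Let $(\beta_N)_{N\ge1}$ be a bounded sequence of non-negative reals ($\beta_N\le O(1)$) and let $\varepsilon_N\in[0,1]$ satisfy $\varepsilon_N=o(1/N)$. Then $$\lim_{N\to\infty}\mathbb E\big[\|\mu_{\beta_N}-\mu_{\beta_N}^{\varepsilon_N}\|_{\mathrm{TV}}\big]=0.$$ As a consequence, transport disorder stability holds: $\lim_{N\to\infty}\mathbb E\big[W_{2,N}(\mu_{\beta_N},\mu_{\beta_N}^{\varepsilon_N})\big]=0$.
   Context: Mixed $p$-spin model. Let $\xi(t)=\sum_{p\ge1}\gamma_p^2t^p$ have radius of convergence strictly larger than $1$ ($\gamma_p\ge0$, not depending on $N$). For each $p$ let $\boldsymbol G^{(p)}\in(\mathbb R^N)^{\otimes p}$ be independent tensors with i.i.d. standard Gaussian entries, write $\boldsymbol G=(\boldsymbol G^{(p)})_p$, and set $H_N(\boldsymbol\sigma)=\sum_p\gamma_pN^{-(p-1)/2}\langle\boldsymbol G^{(p)},\boldsymbol\sigma^{\otimes p}\rangle$, a centered Gaussian process with covariance $\mathbb E[H_N(\boldsymbol\sigma)H_N(\boldsymbol\sigma')]=N\xi(\langle\boldsymbol\sigma,\boldsymbol\sigma'\rangle/N)$. The Gibbs measure is $d\mu_\beta\propto e^{\beta H_N}d\mu_0$, where $\mu_0$ is the uniform probability measure on $\mathcal S_N=\{\boldsymbol\sigma\in\mathbb R^N:\|\boldsymbol\sigma\|_2^2=N\}$ (spherical case) or on $\{\pm1\}^N$ (Ising case). Correlated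 disorder. $\boldsymbol G^{\varepsilon}=(1-\varepsilon)\boldsymbol G+\sqrt{2\varepsilon-\varepsilon^2}\,\boldsymbol W$ with $\boldsymbol W$ an i.i.d. copy of $\boldsymbol G$; $\mu_\beta^\varepsilon$ is the Gibbs measure defined with $\boldsymbol G^\varepsilon$ in place of $\boldsymbol G$. Normalized Wasserstein distance. $W_{2,N}(\mu,\nu)^2=\inf_\pi\frac1N\mathbb E_\pi[\|\boldsymbol X-\boldsymbol Y\|_2^2]$, infimum over couplings $(\boldsymbol X,\boldsymbol Y)\sim\pi$ of $\mu$ and $\nu$. $\|\cdot\|_{\mathrm{TV}}$ is total variation. *)

theory Defs
  imports "HOL-Probability.Probability" "HOL-Library.Landau_Symbols"
begin

(* The dimension N varies inside the statement, so R^N is rendered as the product space of the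
   extensional functions on {..<N}. *)

abbreviation Rn :: "nat \<Rightarrow> (nat \<Rightarrow> real) measure" where
  "Rn N \<equiv> PiM {..<N} (\<lambda>_. borel)"

definition sqnorm :: "nat \<Rightarrow> (nat \<Rightarrow> real) \<Rightarrow> real" where
  "sqnorm N x = (\<Sum>i<N. (x i)\<^sup>2)"

(* Normalized surface measure on the sphere of radius sqrt N, as the cone measure: the image of the
   normalized Lebesgue measure on the unit ball under the radial projection. The value of the
   projection at the origin (a null set for N > 0) is irrelevant. *)
definition sphere_uniform :: "nat \<Rightarrow> (nat \<Rightarrow> real) measure" where
  "sphere_uniform N =
     distr (uniform_measure (PiM {..<N} (\<lambda>_. lborel)) {x \<in> space (Rn N). sqnorm N x \<le> 1})
       (Rn N) (\<lambda>x. \<lambda>i\<in>{..<N}. sqrt (real N) * x i / sqrt (sqnorm N x))"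

definition cube_uniform :: "nat \<Rightarrow> (nat \<Rightarrow> real) measure" where
  "cube_uniform N = distr (uniform_count_measure ({..<N} \<rightarrow>\<^sub>E {-1, 1})) (Rn N) (\<lambda>\<sigma>. \<sigma>)"

(* A disorder is a family g of tensors: g p I is the entry of the p-th tensor at the multi-index I,
   a list of length p with entries below N. *)

type_synonym disorder = "nat \<Rightarrow> nat list \<Rightarrow> real"

definition multi_indices :: "nat \<Rightarrow> nat \<Rightarrow> nat list set" where
  "multi_indices N p = {I. length I = p \<and> set I \<subseteq> {..<N}}"

definition tensor_form :: "nat \<Rightarrow> nat \<Rightarrow> (nat list \<Rightarrow> real) \<Rightarrow> (nat \<Rightarrow> real) \<Rightarrow> real" where
  "tensor_form N p t \<sigma> = (\<Sum>I\<in>multi_indices N p. t I * prod_list (map \<sigma> I))"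

definition hamiltonian :: "(nat \<Rightarrow> real) \<Rightarrow> nat \<Rightarrow> disorder \<Rightarrow> (nat \<Rightarrow> real) \<Rightarrow> real" where
  "hamiltonian \<gamma> N g \<sigma> =
     (\<Sum>p. if p = 0 then 0
          else \<gamma> p * real N powr (- (real p - 1) / 2) * tensor_form N p (g p) \<sigma>)"

definition gibbs ::
    "(nat \<Rightarrow> real) measure \<Rightarrow> (nat \<Rightarrow> real) \<Rightarrow> nat \<Rightarrow> real \<Rightarrow> disorder \<Rightarrow> (nat \<Rightarrow> real) measure" where
  "gibbs \<mu>0 \<gamma> N b g =
     density \<mu>0 (\<lambda>\<sigma>. ennreal (exp (b * hamiltonian \<gamma> N g \<sigma>) /
                                (\<integral>\<tau>. exp (b * hamiltonian \<gamma> N g \<tau>) \<partial>\<mu>0)))"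

(* All entries of g and of w, taken together, are i.i.d. standard Gaussians; that is, g has i.i.d.
   standard Gaussian entries and w is an independent copy of g. *)
definition iid_gaussian_pair ::
    "nat \<Rightarrow> 'a measure \<Rightarrow> ('a \<Rightarrow> disorder) \<Rightarrow> ('a \<Rightarrow> disorder) \<Rightarrow> bool" where
  "iid_gaussian_pair N M g w \<longleftrightarrow>
     prob_space M \<and>
     prob_space.indep_vars M (\<lambda>_. borel)
       (\<lambda>(first, p, I) \<omega>. if first then g \<omega> p I else w \<omega> p I)
       (UNIV \<times> (SIGMA p:{1..}. multi_indices N p)) \<and>
     (\<forall>p\<ge>1. \<forall>I\<in>multi_indices N p.
        distributed M lborel (\<lambda>\<omega>. g \<omega> p I) (\<lambda>x. ennreal (std_normal_density x)) \<and>
        distributed M lborel (\<lambda>\<omega>. w \<omega> p I) (\<lambda>x. ennreal (std_normal_density x)))"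

definition correlate :: "real \<Rightarrow> disorder \<Rightarrow> disorder \<Rightarrow> disorder" where
  "correlate e g w = (\<lambda>p I. (1 - e) * g p I + sqrt (2 * e - e\<^sup>2) * w p I)"

definition tv_dist :: "'b measure \<Rightarrow> 'b measure \<Rightarrow> real" where
  "tv_dist \<mu> \<nu> = (SUP A\<in>sets \<mu>. \<bar>measure \<mu> A - measure \<nu> A\<bar>)"

definition couplings :: "'b measure \<Rightarrow> 'b measure \<Rightarrow> ('b \<times> 'b) measure set" where
  "couplings \<mu> \<nu> = {\<pi>. sets \<pi> = sets (\<mu> \<Otimes>\<^sub>M \<nu>) \<and> distr \<pi> \<mu> fst = \<mu> \<and> distr \<pi> \<nu> snd = \<nu>}"

(* The transport cost is computed in the extended non-negative reals; it is finite for measures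
   carried by a bounded set, the only ones to which this is applied. *)
definition W2 :: "nat \<Rightarrow> (nat \<Rightarrow> real) measure \<Rightarrow> (nat \<Rightarrow> real) measure \<Rightarrow> real" where
  "W2 N \<mu> \<nu> =
     sqrt (enn2real (INF \<pi>\<in>couplings \<mu> \<nu>.
       \<integral>\<^sup>+z. ennreal (sqnorm N (\<lambda>i. fst z i - snd z i) / real N) \<partial>\<pi>))"

end

theory Submission
  imports Defs
begin

text \<open>
  All measures in the statement have a density with respect to the reference measure, so both
  distances are governed by the \<open>L\<^sup>1\<close> distance \<open>D\<close> of the two Gibbs densities: the total variation
  distance is at most \<open>D\<close>, and the maximal coupling, which moves a mass of at most \<open>D\<close> over a
  squared distance of at most \<open>4 N\<close>, gives \<open>W\<^sub>2\<^sup>2 \<le> 4 D\<close>. It remains to see that the expectation of \<open>D\<close>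
  tends to \<open>0\<close>.

  Write \<open>H\<close> and \<open>H'\<close> for the Hamiltonians of the disorder and of its independent copy. The correlated
  Hamiltonian is \<open>(1 - \<epsilon>) H + s H'\<close> with \<open>s\<^sup>2 = 2 \<epsilon> - \<epsilon>\<^sup>2\<close>, and the two summands are treated
  separately by passing through the Gibbs measure at inverse temperature \<open>(1 - \<epsilon>) \<beta>\<close>.

  \<^item> Shrinking the temperature (\<open>tilt_rescaling\<close>). With \<open>f(s) = ln \<integral> exp (s H)\<close>, the Hellinger
    affinity of the Gibbs measures at \<open>\<beta>\<close> and \<open>(1 - \<epsilon>) \<beta>\<close> is the exponential of
    \<open>f((1 - \<epsilon>/2) \<beta>) - f(\<beta>)/2 - f((1 - \<epsilon>) \<beta>)/2\<close>. As \<open>f\<close> is convex and \<open>f(0) = 0\<close>, this exponent is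
    at least \<open>- (\<epsilon>/2) (f(2 \<beta>) - 2 f(\<beta>))\<close>, and the expectation of \<open>f(2 \<beta>) - 2 f(\<beta>)\<close> is \<open>O(N)\<close>.
    Since \<open>\<epsilon> N\<close> tends to \<open>0\<close>, so does the expected squared Hellinger distance.

  \<^item> Adding the noise (\<open>tilt_perturbation\<close>). The density of the intermediate measure depends on the
    disorder alone, while \<open>Y = s \<beta> H'\<close> is independent of it and has, at each point of the sphere,
    variance at most \<open>2 \<epsilon> \<beta>\<^sup>2 N \<xi>(1)\<close>, which tends to \<open>0\<close>. Tilting by \<open>exp Y\<close> costs at most
    twice the mean of \<open>\<bar>exp Y - 1\<bar>\<close> under the intermediate measure; by independence the expectation
    of this mean is at most the largest of the pointwise expectations of \<open>\<bar>exp Y - 1\<bar>\<close>, which is small.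

  The only property of the Gaussian disorder that enters, besides this independence, is the bound
  \<open>exp (t\<^sup>2 N \<xi>(1) / 2)\<close> for the exponential moments of \<open>H\<close> at a point (\<open>hamiltonian_mgf\<close>).
\<close>

section \<open>Total variation and Wasserstein distance of measures with densities\<close>

lemma tv_dist_density_le:
  fixes p q :: "'b \<Rightarrow> real"
  assumes p: "integrable Q p" "\<And>x. p x \<ge> 0" and q: "integrable Q q" "\<And>x. q x \<ge> 0"
  shows "tv_dist (density Q p) (density Q q) \<le> (\<integral>x. \<bar>p x - q x\<bar> \<partial>Q)"
  unfolding tv_dist_def
proof (rule cSUP_least)
  show "sets (density Q p) \<noteq> {}" by (metis empty_iff sets.empty_sets)
next
  fix A assume "A \<in> sets (density Q p)"
  then have A [measurable]: "A \<in> sets Q" by simp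
  have m: "measure (density Q r) A = (\<integral>x. r x * indicator A x \<partial>Q)" 
    if r: "integrable Q r" "\<And>x. r x \<ge> 0" for r :: "'b \<Rightarrow> real"
  proof -
    have [measurable]: "r \<in> borel_measurable Q" using r by auto
    have "emeasure (density Q r) A = (\<integral>\<^sup>+x. ennreal (r x * indicator A x) \<partial>Q)"
      by (subst emeasure_density) (auto intro!: nn_integral_cong simp: indicator_def)
    also have "\<dots> = ennreal (\<integral>x. r x * indicator A x \<partial>Q)"
      by (intro nn_integral_eq_integral) (auto intro!: integrable_real_mult_indicator r simp: r)
    finally show ?thesis
      by (simp add: measure_def r integral_nonneg_AE)
  qed
  have i: "integrable Q (\<lambda>x. r x * indicator A x)" if "integrable Q r" for r :: "'b \<Rightarrow> real"
    using that by (intro integrable_real_mult_indicator A)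
  have "measure (density Q p) A - measure (density Q q) A = (\<integral>x. (p x - q x) * indicator A x \<partial>Q)"
    using i[OF p(1)] i[OF q(1)] by (simp add: m p q left_diff_distrib)
  also have "\<bar>\<dots>\<bar> \<le> (\<integral>x. \<bar>(p x - q x) * indicator A x\<bar> \<partial>Q)"
    by (rule integral_abs_bound)
  also have "\<dots> \<le> (\<integral>x. \<bar>p x - q x\<bar> \<partial>Q)"
    by (intro integral_mono_AE integrable_abs i Bochner_Integration.integrable_diff p q)
       (auto simp: indicator_def)
  finally show "\<bar>measure (density Q p) A - measure (density Q q) A\<bar> \<le> (\<integral>x. \<bar>p x - q x\<bar> \<partial>Q)" .
qed

text \<open>
  A supremum of reals is meaningful only for a bounded set; here the bound is the total mass.
\<close>

lemma tv_dist_density_nonneg: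
  fixes p q :: "'b \<Rightarrow> real"
  assumes p: "integrable Q p" "\<And>x. p x \<ge> 0" and q: "integrable Q q" "\<And>x. q x \<ge> 0"
  shows "0 \<le> tv_dist (density Q p) (density Q q)"
proof -
  have fin: "finite_measure (density Q r)" if "integrable Q r" "\<And>x. r x \<ge> 0" for r :: "'b \<Rightarrow> real"
    by (rule finite_measureI)
       (use that nn_integral_eq_integral[of Q r] in \<open>auto simp: emeasure_density cong: nn_integral_cong\<close>)
  interpret p: finite_measure "density Q p" using p by (rule fin)
  interpret q: finite_measure "density Q q" using q by (rule fin)
  have "\<bar>measure (density Q p) A - measure (density Q q) A\<bar>
      \<le> measure (density Q p) (space Q) + measure (density Q q) (space Q)" for A
    using p.bounded_measure[of A] q.bounded_measure[of A] measure_nonneg[of "density Q p" A]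
      measure_nonneg[of "density Q q" A] unfolding space_density by linarith
  then have "bdd_above ((\<lambda>A. \<bar>measure (density Q p) A - measure (density Q q) A\<bar>) ` sets (density Q p))"
    by (intro bdd_aboveI2)
  then show ?thesis
    unfolding tv_dist_def by (intro cSUP_upper2[where x="{}"]) auto
qed

text \<open>
  The maximal coupling leaves the common part \<open>min p q\<close> of the two densities on the diagonal and pairs
  the excess \<open>p - min p q\<close> independently with the excess \<open>q - min p q\<close>. It is realised as the image of
  a density on \<open>bool \<times> 'b \<times> 'b\<close>, the Boolean telling the two parts apart. If the densities agree almost
  everywhere, then the normalisation is \<open>0\<close>, and the convention \<open>x / 0 = 0\<close> correctly removes the
  second part.
\<close>

definition coupling_weight :: "'b measure \<Rightarrow> ('b \<Rightarrow> real) \<Rightarrow> ('b \<Rightarrow> real) \<Rightarrow> bool \<times> 'b \<times> 'b \<Rightarrow> real" where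
  "coupling_weight Q p q = (\<lambda>(b, x, y). if b then min (p x) (q x)
     else (p x - min (p x) (q x)) * (q y - min (p y) (q y)) / (1 - (\<integral>x. min (p x) (q x) \<partial>Q)))"

definition maximal_coupling :: "'b measure \<Rightarrow> ('b \<Rightarrow> real) \<Rightarrow> ('b \<Rightarrow> real) \<Rightarrow> ('b \<times> 'b) measure" where
  "maximal_coupling Q p q =
     distr (density (count_space UNIV \<Otimes>\<^sub>M (Q \<Otimes>\<^sub>M Q)) (coupling_weight Q p q))
       (Q \<Otimes>\<^sub>M Q) (\<lambda>(b, x, y). if b then (x, x) else (x, y))"

lemma nn_integral_maximal_coupling:
  fixes p q :: "'b \<Rightarrow> real"
  assumes Q: "prob_space Q"
    and p: "integrable Q p" "\<And>x. p x \<ge> 0" "(\<integral>x. p x \<partial>Q) = 1"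
    and q: "integrable Q q" "\<And>x. q x \<ge> 0" "(\<integral>x. q x \<partial>Q) = 1"
    and f [measurable]: "f \<in> borel_measurable (Q \<Otimes>\<^sub>M Q)"
  defines "m \<equiv> \<lambda>x. min (p x) (q x)"
  shows "(\<integral>\<^sup>+z. f z \<partial>maximal_coupling Q p q) = (\<integral>\<^sup>+x. m x * f (x, x) \<partial>Q) +
     (\<integral>\<^sup>+x. (\<integral>\<^sup>+y. ennreal ((p x - m x) * (q y - m y) / (1 - (\<integral>x. m x \<partial>Q))) * f (x, y) \<partial>Q) \<partial>Q)"
proof -
  interpret prob_space Q by fact
  interpret QQ: pair_prob_space Q Q ..
  have [measurable]: "p \<in> borel_measurable Q" "q \<in> borel_measurable Q" using p q by auto
  have [measurable]: "m \<in> borel_measurable Q" unfolding m_def by simp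
  have cw: "coupling_weight Q p q = (\<lambda>(b, x, y). if b then m x else (p x - m x) * (q y - m y) / (1 - (\<integral>x. m x \<partial>Q)))"
    by (auto simp: coupling_weight_def m_def)
  have [measurable]: "coupling_weight Q p q \<in> borel_measurable (count_space UNIV \<Otimes>\<^sub>M (Q \<Otimes>\<^sub>M Q))"
    unfolding cw by measurable
  have "(\<integral>\<^sup>+z. f z \<partial>maximal_coupling Q p q) = (\<integral>\<^sup>+z. coupling_weight Q p q z * 
      f ((\<lambda>(b, x, y). if b then (x, x) else (x, y)) z) \<partial>(count_space UNIV \<Otimes>\<^sub>M (Q \<Otimes>\<^sub>M Q)))"
    unfolding maximal_coupling_def by (simp add: nn_integral_distr nn_integral_density)
  also have "\<dots> = (\<integral>\<^sup>+b. \<integral>\<^sup>+xy. coupling_weight Q p q (b, xy) * f ((\<lambda>(b, x, y). if b then (x, x) else (x, y)) (b, xy))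
      \<partial>(Q \<Otimes>\<^sub>M Q) \<partial>count_space UNIV)"
    by (subst QQ.nn_integral_fst[symmetric]) auto
  also have "\<dots> = (\<integral>\<^sup>+xy. coupling_weight Q p q (True, xy) * f ((\<lambda>(b, x, y). if b then (x, x) else (x, y)) (True, xy)) \<partial>(Q \<Otimes>\<^sub>M Q))
     + (\<integral>\<^sup>+xy. coupling_weight Q p q (False, xy) * f ((\<lambda>(b, x, y). if b then (x, x) else (x, y)) (False, xy)) \<partial>(Q \<Otimes>\<^sub>M Q))"
    by (simp add: nn_integral_count_space_finite UNIV_bool add.commute)
  also have "\<dots> = (\<integral>\<^sup>+x. m x * f (x, x) \<partial>Q) +
     (\<integral>\<^sup>+x. (\<integral>\<^sup>+y. ennreal ((p x - m x) * (q y - m y) / (1 - (\<integral>x. m x \<partial>Q))) * f (x, y) \<partial>Q) \<partial>Q)"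
    by (subst (1 2) nn_integral_fst[symmetric])
       (auto simp: cw emeasure_space_1)
  finally show ?thesis .
qed

text \<open>
  Both excesses have the same mass \<open>c\<close>, the normalisation of the product part, so integrating out one
  variable restores the excess in the other. The mass \<open>c\<close> that leaves the diagonal is at most the
  \<open>L\<^sup>1\<close> distance of the densities, which bounds the cost.
\<close>

lemma
  fixes p q :: "'b \<Rightarrow> real"
  assumes Q: "prob_space Q"
    and p: "integrable Q p" "\<And>x. p x \<ge> 0" "(\<integral>x. p x \<partial>Q) = 1"
    and q: "integrable Q q" "\<And>x. q x \<ge> 0" "(\<integral>x. q x \<partial>Q) = 1"
  shows maximal_coupling_in_couplings: "maximal_coupling Q p q \<in> couplings (density Q p) (density Q q)"
    and maximal_coupling_cost: "f \<in> borel_measurable (Q \<Otimes>\<^sub>M Q) \<Longrightarrow> (\<And>x. f (x, x) = 0) \<Longrightarrow> 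
      AE x in Q. AE y in Q. f (x, y) \<le> ennreal C \<Longrightarrow> C \<ge> 0 \<Longrightarrow>
      (\<integral>\<^sup>+z. f z \<partial>maximal_coupling Q p q) \<le> ennreal (C * (\<integral>x. \<bar>p x - q x\<bar> \<partial>Q))"
proof -
  interpret prob_space Q by fact
  define m where "m x = min (p x) (q x)" for x
  define c where "c = 1 - (\<integral>x. m x \<partial>Q)"
  have pm [measurable]: "p \<in> borel_measurable Q" "q \<in> borel_measurable Q" using p q by auto
  have mm [measurable]: "m \<in> borel_measurable Q" unfolding m_def[abs_def] by simp
  have m: "integrable Q m" "\<And>x. m x \<ge> 0" "\<And>x. m x \<le> p x" "\<And>x. m x \<le> q x"
    using p q by (auto simp: m_def[abs_def])
  have excess: "(\<integral>\<^sup>+x. ennreal (r x - m x) \<partial>Q) = ennreal c" 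
    if r: "integrable Q r" "\<And>x. m x \<le> r x" "(\<integral>x. r x \<partial>Q) = 1" for r
    using r m by (subst nn_integral_eq_integral) (auto simp: c_def)
  have c0: "c \<ge> 0" 
    using integral_mono[OF m(1) p(1)] m p by (simp add: c_def)
  have cz: "AE x in Q. r x = m x"
    if r: "integrable Q r" "\<And>x. m x \<le> r x" "(\<integral>x. r x \<partial>Q) = 1" and "c = 0" for r
  proof -
    have [measurable]: "r \<in> borel_measurable Q" using r by auto
    have "(\<integral>\<^sup>+x. ennreal (r x - m x) \<partial>Q) = 0" using excess[OF r] \<open>c = 0\<close> by simp
    then have "AE x in Q. ennreal (r x - m x) = 0" by (subst (asm) nn_integral_0_iff_AE) auto
    then show ?thesis by eventually_elim (use r(2) in \<open>auto simp: ennreal_eq_0_iff antisym\<close>)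
  qed
  note nn = nn_integral_maximal_coupling[OF Q p q, folded m_def c_def]
  have sets_mc [simp, measurable_cong]: "sets (maximal_coupling Q p q) = sets (Q \<Otimes>\<^sub>M Q)"
    by (simp add: maximal_coupling_def)
  have cancel: "ennreal (u * v / c) = ennreal (u / c) * ennreal v" if "u \<ge> 0" "v \<ge> 0" for u v
    using that c0 by (simp add: ennreal_mult[symmetric])
  have un: "ennreal (u / c) * ennreal c = ennreal u" if "u \<ge> 0" "c = 0 \<longrightarrow> u = 0" for u
    using that c0 by (cases "c = 0") (auto simp: ennreal_mult[symmetric])
  note exp = excess[OF p(1) m(3) p(3)] and exq = excess[OF q(1) m(4) q(3)]
  have fst_marg: "distr (maximal_coupling Q p q) (density Q p) fst = density Q p"
  proof (rule measure_eqI)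
    fix A assume "A \<in> sets (distr (maximal_coupling Q p q) (density Q p) fst)"
    then have [measurable]: "A \<in> sets Q" by simp
    have "emeasure (distr (maximal_coupling Q p q) (density Q p) fst) A
      = (\<integral>\<^sup>+z. indicator A (fst z) \<partial>maximal_coupling Q p q)"
      by (subst nn_integral_distr[symmetric, where M'="density Q p" and f="indicator A"])
         (auto simp: nn_integral_indicator)
    also have "\<dots> = (\<integral>\<^sup>+x. ennreal (m x) * indicator A x \<partial>Q) +
     (\<integral>\<^sup>+x. (\<integral>\<^sup>+y. ennreal ((p x - m x) * (q y - m y) / c) * indicator A x \<partial>Q) \<partial>Q)"
      by (subst nn) auto
    also have "(\<integral>\<^sup>+x. (\<integral>\<^sup>+y. ennreal ((p x - m x) * (q y - m y) / c) * indicator A x \<partial>Q) \<partial>Q)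
       = (\<integral>\<^sup>+x. ennreal (p x - m x) * indicator A x \<partial>Q)"
    proof (rule nn_integral_cong_AE)
      have "AE x in Q. c = 0 \<longrightarrow> p x = m x" using cz[OF p(1) m(3) p(3)] by (cases "c = 0") auto
      then show "AE x in Q. (\<integral>\<^sup>+y. ennreal ((p x - m x) * (q y - m y) / c) * indicator A x \<partial>Q) = ennreal (p x - m x) * indicator A x"
      proof eventually_elim
        case (elim x)
        show ?case
          using m(3,4) elim by (simp add: cancel nn_integral_multc nn_integral_cmult exq un)
      qed
    qed
    also have "(\<integral>\<^sup>+x. ennreal (m x) * indicator A x \<partial>Q) + (\<integral>\<^sup>+x. ennreal (p x - m x) * indicator A x \<partial>Q)
       = (\<integral>\<^sup>+x. ennreal (p x) * indicator A x \<partial>Q)"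
      using m(2,3) by (subst nn_integral_add[symmetric])
        (auto intro!: nn_integral_cong simp: distrib_right[symmetric] simp flip: ennreal_plus)
    also have "\<dots> = emeasure (density Q p) A"
      by (simp add: emeasure_density)
    finally show "emeasure (distr (maximal_coupling Q p q) (density Q p) fst) A = emeasure (density Q p) A" .
  qed simp
  have snd_marg: "distr (maximal_coupling Q p q) (density Q q) snd = density Q q"
  proof (rule measure_eqI)
    fix A assume "A \<in> sets (distr (maximal_coupling Q p q) (density Q q) snd)"
    then have [measurable]: "A \<in> sets Q" by simp
    have "emeasure (distr (maximal_coupling Q p q) (density Q q) snd) A
      = (\<integral>\<^sup>+z. indicator A (snd z) \<partial>maximal_coupling Q p q)"
      by (subst nn_integral_distr[symmetric, where M'="density Q q" and f="indicator A"])
         (auto simp: nn_integral_indicator)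
    also have "\<dots> = (\<integral>\<^sup>+x. ennreal (m x) * indicator A x \<partial>Q) +
     (\<integral>\<^sup>+x. (\<integral>\<^sup>+y. ennreal ((p x - m x) * (q y - m y) / c) * indicator A y \<partial>Q) \<partial>Q)"
      by (subst nn) auto
    also have "(\<integral>\<^sup>+x. (\<integral>\<^sup>+y. ennreal ((p x - m x) * (q y - m y) / c) * indicator A y \<partial>Q) \<partial>Q)
       = (\<integral>\<^sup>+y. (\<integral>\<^sup>+x. ennreal ((p x - m x) * (q y - m y) / c) * indicator A y \<partial>Q) \<partial>Q)"
    proof -
      interpret QQ: pair_sigma_finite Q Q ..
      show ?thesis by (rule QQ.Fubini'[symmetric]) simp
    qed
    also have "\<dots> = (\<integral>\<^sup>+y. ennreal (q y - m y) * indicator A y \<partial>Q)"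
    proof (rule nn_integral_cong_AE)
      have "AE x in Q. c = 0 \<longrightarrow> q x = m x" using cz[OF q(1) m(4) q(3)] by (cases "c = 0") auto
      then show "AE y in Q. (\<integral>\<^sup>+x. ennreal ((p x - m x) * (q y - m y) / c) * indicator A y \<partial>Q) = ennreal (q y - m y) * indicator A y"
      proof eventually_elim
        case (elim y)
        have "ennreal ((p x - m x) * (q y - m y) / c) = ennreal ((q y - m y) / c) * ennreal (p x - m x)" for x
          using cancel[of "q y - m y" "p x - m x"] m(3,4) by (simp add: mult.commute)
        then show ?case
          using m(3,4) elim by (simp add: nn_integral_multc nn_integral_cmult exp un)
      qed
    qed
    also have "(\<integral>\<^sup>+x. ennreal (m x) * indicator A x \<partial>Q) + (\<integral>\<^sup>+x. ennreal (q x - m x) * indicator A x \<partial>Q)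
       = (\<integral>\<^sup>+x. ennreal (q x) * indicator A x \<partial>Q)"
      using m(2,4) by (subst nn_integral_add[symmetric])
        (auto intro!: nn_integral_cong simp: distrib_right[symmetric] simp flip: ennreal_plus)
    also have "\<dots> = emeasure (density Q q) A"
      by (simp add: emeasure_density)
    finally show "emeasure (distr (maximal_coupling Q p q) (density Q q) snd) A = emeasure (density Q q) A" .
  qed simp
  show "maximal_coupling Q p q \<in> couplings (density Q p) (density Q q)"
    using fst_marg snd_marg sets_mc by (simp add: couplings_def cong: sets_pair_measure_cong)
  assume f [measurable]: "f \<in> borel_measurable (Q \<Otimes>\<^sub>M Q)" and diag: "\<And>x. f (x, x) = 0"
    and C: "AE x in Q. AE y in Q. f (x, y) \<le> ennreal C" "C \<ge> 0"
  have "(\<integral>\<^sup>+z. f z \<partial>maximal_coupling Q p q) = 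
     (\<integral>\<^sup>+x. (\<integral>\<^sup>+y. ennreal ((p x - m x) * (q y - m y) / c) * f (x, y) \<partial>Q) \<partial>Q)"
    by (subst nn) (auto simp: diag)
  also have "\<dots> \<le> (\<integral>\<^sup>+x. (\<integral>\<^sup>+y. ennreal ((p x - m x) * (q y - m y) / c) * ennreal C \<partial>Q) \<partial>Q)"
  proof (rule nn_integral_mono_AE)
    show "AE x in Q. (\<integral>\<^sup>+y. ennreal ((p x - m x) * (q y - m y) / c) * f (x, y) \<partial>Q)
      \<le> (\<integral>\<^sup>+y. ennreal ((p x - m x) * (q y - m y) / c) * ennreal C \<partial>Q)"
      using C(1)
    proof eventually_elim
      case (elim x)
      then show ?case 
        by (intro nn_integral_mono_AE) (auto elim!: eventually_mono intro: mult_left_mono)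
    qed
  qed
  also have "\<dots> = (\<integral>\<^sup>+x. ennreal (p x - m x) * ennreal C \<partial>Q)"
  proof (rule nn_integral_cong_AE)
    have "AE x in Q. c = 0 \<longrightarrow> p x = m x" using cz[OF p(1) m(3) p(3)] by (cases "c = 0") auto
    then show "AE x in Q. (\<integral>\<^sup>+y. ennreal ((p x - m x) * (q y - m y) / c) * ennreal C \<partial>Q) = ennreal (p x - m x) * ennreal C"
    proof eventually_elim
      case (elim x)
      show ?case
        using m(3,4) elim by (simp add: cancel nn_integral_multc nn_integral_cmult exq un)
    qed
  qed
  also have "\<dots> \<le> (\<integral>\<^sup>+x. ennreal C * ennreal \<bar>p x - q x\<bar> \<partial>Q)"
    using C(2) p(2) q(2) by (intro nn_integral_mono) (auto simp: m_def mult.commute intro!: mult_left_mono ennreal_leI)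
  also have "\<dots> = ennreal (C * (\<integral>x. \<bar>p x - q x\<bar> \<partial>Q))"
    using C(2) p(1) q(1) by (subst nn_integral_cmult, simp, subst nn_integral_eq_integral)
      (auto simp: ennreal_mult integral_nonneg_AE)
  finally show "(\<integral>\<^sup>+z. f z \<partial>maximal_coupling Q p q) \<le> ennreal (C * (\<integral>x. \<bar>p x - q x\<bar> \<partial>Q))" .
qed

lemma sqnorm_diff_le: "sqnorm N (\<lambda>i. x i - y i) \<le> 2 * sqnorm N x + 2 * sqnorm N y"
proof -
  have "(x i - y i)\<^sup>2 \<le> 2 * (x i)\<^sup>2 + 2 * (y i)\<^sup>2" for i
    using zero_le_power2[of "x i + y i"] by (simp add: power2_eq_square algebra_simps)
  then show ?thesis
    unfolding sqnorm_def by (auto simp: sum_distrib_left simp flip: sum.distrib intro!: sum_mono)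
qed

lemma measurable_sqnorm [measurable]: "sqnorm N \<in> borel_measurable (Rn N)"
  unfolding sqnorm_def by measurable

text \<open>
  Two points of the sphere of radius \<open>sqrt N\<close> are at squared distance at most \<open>4 N\<close>.
\<close>

lemma W2_density_le:
  fixes p q :: "(nat \<Rightarrow> real) \<Rightarrow> real"
  assumes Q: "prob_space Q" and setsQ [measurable_cong]: "sets Q = sets (Rn N)" and N: "N \<ge> 1"
    and sphere: "AE x in Q. sqnorm N x = N"
    and p: "integrable Q p" "\<And>x. p x \<ge> 0" "(\<integral>x. p x \<partial>Q) = 1"
    and q: "integrable Q q" "\<And>x. q x \<ge> 0" "(\<integral>x. q x \<partial>Q) = 1"
  shows "W2 N (density Q p) (density Q q) \<le> sqrt (4 * (\<integral>x. \<bar>p x - q x\<bar> \<partial>Q))"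
proof -
  define cost where "cost z = ennreal (sqnorm N (\<lambda>i. fst z i - snd z i) / real N)" for z :: "(nat \<Rightarrow> real) \<times> (nat \<Rightarrow> real)"
  have [measurable]: "cost \<in> borel_measurable (Q \<Otimes>\<^sub>M Q)"
    unfolding cost_def[abs_def] sqnorm_def by measurable
  have "AE x in Q. AE y in Q. cost (x, y) \<le> ennreal 4"
    using sphere
  proof eventually_elim
    case (elim x)
    note x = this
    show ?case using sphere
    proof eventually_elim
      case (elim y)
      then show ?case using x sqnorm_diff_le[of N x y] N 
        unfolding cost_def by (auto intro!: ennreal_leI simp: field_simps simp del: ennreal_numeral)
    qed
  qed
  then have "(\<integral>\<^sup>+z. cost z \<partial>maximal_coupling Q p q) \<le> ennreal (4 * (\<integral>x. \<bar>p x - q x\<bar> \<partial>Q))"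
    by (intro maximal_coupling_cost[OF Q p q]) (auto simp: cost_def sqnorm_def)
  then have "(INF \<pi>\<in>couplings (density Q p) (density Q q). \<integral>\<^sup>+z. cost z \<partial>\<pi>) \<le> ennreal (4 * (\<integral>x. \<bar>p x - q x\<bar> \<partial>Q))"
    by (intro INF_lower2[OF maximal_coupling_in_couplings[OF Q p q]])
  then have "enn2real (INF \<pi>\<in>couplings (density Q p) (density Q q). \<integral>\<^sup>+z. cost z \<partial>\<pi>) \<le> 4 * (\<integral>x. \<bar>p x - q x\<bar> \<partial>Q)"
    by (intro enn2real_leI) (auto intro!: integral_nonneg_AE)
  then show ?thesis
    unfolding W2_def cost_def by simp
qed

section \<open>Exponential tilts of a probability measure\<close>

definition partition_fn :: "'b measure \<Rightarrow> ('b \<Rightarrow> real) \<Rightarrow> real" where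
  "partition_fn Q h = (\<integral>x. exp (h x) \<partial>Q)"

text \<open>
  The density of the Gibbs measure with energy \<open>h\<close>. If \<open>exp h\<close> is not integrable, then the partition
  function is \<open>0\<close> by convention and so is the density.
\<close>

definition tilt :: "'b measure \<Rightarrow> ('b \<Rightarrow> real) \<Rightarrow> 'b \<Rightarrow> real" where
  "tilt Q h x = exp (h x) / partition_fn Q h"

context prob_space
begin

lemma partition_fn_pos: "integrable M (\<lambda>x. exp (h x)) \<Longrightarrow> partition_fn M h > (0 :: real)"
proof -
  assume i: "integrable M (\<lambda>x. exp (h x :: real))"
  have "partition_fn M h \<noteq> 0"
    unfolding partition_fn_def using integral_nonneg_eq_0_iff_AE[OF i] by (auto simp: AE_False)
  moreover have "partition_fn M h \<ge> 0" unfolding partition_fn_def by (intro integral_nonneg_AE) auto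
  ultimately show ?thesis by linarith
qed

lemma tilt_nonneg: "tilt M h x \<ge> 0"
  unfolding tilt_def partition_fn_def by (intro divide_nonneg_nonneg integral_nonneg_AE) auto

lemma tilt_density:
  assumes "integrable M (\<lambda>x. exp (h x))"
  shows "integrable M (tilt M h)" "(\<integral>x. tilt M h x \<partial>M) = 1"
  using partition_fn_pos[OF assms] assms by (auto simp: tilt_def[abs_def] partition_fn_def)

text \<open>
  With \<open>r = tilt h\<close> and \<open>m = \<integral> r exp y\<close>, the perturbed density is \<open>r exp y / m\<close>. Replacing \<open>exp y\<close> by
  \<open>1\<close> costs \<open>\<integral> r \<bar>exp y - 1\<bar>\<close>, and correcting the normalisation costs \<open>\<bar>m - 1\<bar>\<close>, which is at most the
  same integral.
\<close>

lemma tilt_perturbation: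
  assumes h: "integrable M (\<lambda>x. exp (h x))" and [measurable]: "y \<in> borel_measurable M" "h \<in> borel_measurable M"
    and y: "integrable M (\<lambda>x. tilt M h x * \<bar>exp (y x) - 1\<bar>)"
  shows "integrable M (\<lambda>x. exp (h x + y x))"
    and "(\<integral>x. \<bar>tilt M h x - tilt M (\<lambda>x. h x + y x) x\<bar> \<partial>M) \<le> 2 * (\<integral>x. tilt M h x * \<bar>exp (y x) - 1\<bar> \<partial>M)"
proof -
  define r where "r = tilt M h"
  define m where "m = (\<integral>x. r x * exp (y x) \<partial>M)"
  define d where "d = (\<integral>x. r x * \<bar>exp (y x) - 1\<bar> \<partial>M)"
  note r = tilt_density[OF h, folded r_def] tilt_nonneg[of h, folded r_def]
  have [measurable]: "r \<in> borel_measurable M" using r by auto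
  have yi: "integrable M (\<lambda>x. r x * \<bar>exp (y x) - 1\<bar>)" using y by (simp add: r_def)
  have ry: "integrable M (\<lambda>x. r x * exp (y x))"
  proof (rule Bochner_Integration.integrable_bound)
    show "integrable M (\<lambda>x. r x + r x * \<bar>exp (y x) - 1\<bar>)" using r yi by auto
    show "AE x in M. norm (r x * exp (y x)) \<le> norm (r x + r x * \<bar>exp (y x) - 1\<bar>)"
    proof (rule AE_I2)
      fix x
      have "r x * exp (y x) \<le> r x * (1 + \<bar>exp (y x) - 1\<bar>)"
        using r(3) by (intro mult_left_mono) auto
      then show "norm (r x * exp (y x)) \<le> norm (r x + r x * \<bar>exp (y x) - 1\<bar>)"
        using r(3)[of x] by (simp add: distrib_left abs_mult)
    qed
  qed simp
  have Z: "partition_fn M h > 0" by (rule partition_fn_pos[OF h])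
  have exp_eq: "exp (h x + y x) = partition_fn M h * (r x * exp (y x))" for x
    using Z by (simp add: r_def tilt_def exp_add)
  show hy: "integrable M (\<lambda>x. exp (h x + y x))"
    unfolding exp_eq by (intro integrable_mult_right ry)
  have Zhy: "partition_fn M (\<lambda>x. h x + y x) = partition_fn M h * m"
    by (simp add: partition_fn_def[of M "\<lambda>x. h x + y x"] exp_eq m_def)
  then have m: "m > 0" using partition_fn_pos[OF hy] Z by (simp add: zero_less_mult_iff)
  have t: "tilt M (\<lambda>x. h x + y x) x = r x * exp (y x) / m" for x
    unfolding tilt_def[of M "\<lambda>x. h x + y x"] Zhy unfolding exp_eq using Z by simp
  have "m - 1 = (\<integral>x. r x * exp (y x) - r x \<partial>M)"
    using ry r by (simp add: m_def)
  also have "\<bar>\<dots>\<bar> \<le> (\<integral>x. \<bar>r x * exp (y x) - r x\<bar> \<partial>M)" by (rule integral_abs_bound)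
  also have "\<dots> = d"
  proof -
    have "r x * exp (y x) - r x = r x * (exp (y x) - 1)" for x by (simp add: algebra_simps)
    then show ?thesis unfolding d_def using r(3) by (simp add: abs_mult)
  qed
  finally have md: "\<bar>m - 1\<bar> \<le> d" .
  have "(\<integral>x. \<bar>r x - tilt M (\<lambda>x. h x + y x) x\<bar> \<partial>M) \<le> 
     (\<integral>x. r x * \<bar>exp (y x) - 1\<bar> + \<bar>m - 1\<bar> / m * (r x * exp (y x)) \<partial>M)"
  proof (rule integral_mono_AE)
    show "AE x in M. \<bar>r x - tilt M (\<lambda>x. h x + y x) x\<bar> \<le> r x * \<bar>exp (y x) - 1\<bar> + \<bar>m - 1\<bar> / m * (r x * exp (y x))"
    proof (rule AE_I2)
      fix x
      have "r x - r x * exp (y x) / m = - (r x * (exp (y x) - 1)) + (m - 1) / m * (r x * exp (y x))"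
        using m by (simp add: field_simps)
      also have "\<bar>\<dots>\<bar> \<le> \<bar>r x * (exp (y x) - 1)\<bar> + \<bar>(m - 1) / m * (r x * exp (y x))\<bar>"
        using abs_triangle_ineq[of "- (r x * (exp (y x) - 1))"] unfolding abs_minus_cancel .
      finally show "\<bar>r x - tilt M (\<lambda>x. h x + y x) x\<bar> \<le> r x * \<bar>exp (y x) - 1\<bar> + \<bar>m - 1\<bar> / m * (r x * exp (y x))"
        unfolding t using m r(3)[of x] by (simp add: abs_mult abs_divide)
    qed
  qed (use r yi ry in \<open>auto simp: t\<close>)
  also have "\<dots> = d + \<bar>m - 1\<bar>"
    using yi ry m by (simp add: d_def m_def[symmetric])
  finally show "(\<integral>x. \<bar>tilt M h x - tilt M (\<lambda>x. h x + y x) x\<bar> \<partial>M) \<le> 2 * (\<integral>x. tilt M h x * \<bar>exp (y x) - 1\<bar> \<partial>M)"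
    using md by (simp add: r_def d_def)
qed

text \<open>
  Hoelder's inequality. After subtracting the logarithms of the partition functions from \<open>u\<close> and \<open>v\<close>,
  it is the pointwise convexity of the exponential function, integrated.
\<close>

lemma log_partition_convex:
  assumes u: "integrable M (\<lambda>x. exp (u x))" and v: "integrable M (\<lambda>x. exp (v x))"
    and [measurable]: "u \<in> borel_measurable M" "v \<in> borel_measurable M" and l: "0 \<le> l" "l \<le> 1"
  shows "integrable M (\<lambda>x. exp (l * u x + (1 - l) * v x))"
    and "ln (partition_fn M (\<lambda>x. l * u x + (1 - l) * v x)) \<le> l * ln (partition_fn M u) + (1 - l) * ln (partition_fn M v)"
proof -
  define a where "a = ln (partition_fn M u)"
  define b where "b = ln (partition_fn M v)"
  have Z: "exp a = partition_fn M u" "exp b = partition_fn M v"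
    using partition_fn_pos[OF u] partition_fn_pos[OF v] by (auto simp: a_def b_def)
  have le: "exp (l * (s - a) + (1 - l) * (t - b)) \<le> l * exp (s - a) + (1 - l) * exp (t - b)" for s t
    using convex_onD[OF exp_convex, of "1 - l" "s - a" "t - b"] l by simp
  have i: "integrable M (\<lambda>x. l * exp (u x - a) + (1 - l) * exp (v x - b))"
    using u v by (auto simp: exp_diff)
  have ii: "integrable M (\<lambda>x. exp (l * (u x - a) + (1 - l) * (v x - b)))"
  proof (rule Bochner_Integration.integrable_bound[OF i])
    show "AE x in M. norm (exp (l * (u x - a) + (1 - l) * (v x - b))) \<le> norm (l * exp (u x - a) + (1 - l) * exp (v x - b))"
    proof (rule AE_I2)
      fix x
      show "norm (exp (l * (u x - a) + (1 - l) * (v x - b))) \<le> norm (l * exp (u x - a) + (1 - l) * exp (v x - b))"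
        using le[of "u x" "v x"] by (simp add: abs_le_iff)
    qed
  qed simp
  have e: "exp (l * u x + (1 - l) * v x) = exp (l * a + (1 - l) * b) * exp (l * (u x - a) + (1 - l) * (v x - b))" for x
    by (simp add: algebra_simps flip: exp_add)
  show j: "integrable M (\<lambda>x. exp (l * u x + (1 - l) * v x))"
    unfolding e using ii by auto
  have "(\<integral>x. exp (l * (u x - a) + (1 - l) * (v x - b)) \<partial>M) \<le> (\<integral>x. l * exp (u x - a) + (1 - l) * exp (v x - b) \<partial>M)"
    using ii i le by (intro integral_mono) auto
  also have "\<dots> = 1"
    using u v partition_fn_pos[OF u] partition_fn_pos[OF v] by (simp add: exp_diff Z) (simp add: partition_fn_def)
  finally have "partition_fn M (\<lambda>x. l * u x + (1 - l) * v x) \<le> exp (l * a + (1 - l) * b) * 1"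
    unfolding partition_fn_def e by simp
  then show "ln (partition_fn M (\<lambda>x. l * u x + (1 - l) * v x)) \<le> l * ln (partition_fn M u) + (1 - l) * ln (partition_fn M v)"
    using partition_fn_pos[OF j] by (simp add: ln_le_cancel_iff[symmetric] del: ln_le_cancel_iff)
      (simp add: a_def b_def)
qed

lemma partition_fn_zero [simp]: "partition_fn M (\<lambda>x. 0) = 1"
  by (simp add: partition_fn_def prob_space)

text \<open>
  The point \<open>0\<close> lies between \<open>k\<close> and \<open>-1\<close>, so convexity of \<open>s \<mapsto> ln \<integral> exp (s g)\<close>, which vanishes at
  \<open>0\<close>, controls the value at \<open>k\<close> from below by the value at \<open>-1\<close>. This keeps expectations of the
  logarithm of a partition function away from \<open>- \<infinity>\<close> by an exponential moment alone.
\<close>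

lemma neg_log_partition_le:
  assumes g: "integrable M (\<lambda>x. exp (k * g x))" "integrable M (\<lambda>x. exp (- g x))"
    and [measurable]: "g \<in> borel_measurable M" and k: "k \<ge> 0"
  shows "- ln (partition_fn M (\<lambda>x. k * g x)) \<le> k * partition_fn M (\<lambda>x. - g x)"
proof -
  \<comment> \<open>The weight that makes 0 the convex combination of k and -1.\<close>
  define l where "l = 1 / (1 + k)"
  have l: "0 \<le> l" "l \<le> 1" "l > 0" "1 - l = k * l" using k by (auto simp: l_def field_simps)
  have "(\<lambda>x. l * (k * g x) + (1 - l) * (- g x)) = (\<lambda>x. 0)"
    unfolding l(4) by simp
  then have "0 \<le> l * ln (partition_fn M (\<lambda>x. k * g x)) + (1 - l) * ln (partition_fn M (\<lambda>x. - g x))"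
    using log_partition_convex(2)[OF g _ _ l(1,2)] by (simp del: mult_minus_right)
  also have "\<dots> = l * (ln (partition_fn M (\<lambda>x. k * g x)) + k * ln (partition_fn M (\<lambda>x. - g x)))"
    unfolding l(4) by (simp add: algebra_simps)
  finally have "- ln (partition_fn M (\<lambda>x. k * g x)) \<le> k * ln (partition_fn M (\<lambda>x. - g x))"
    using l(3) by (simp add: zero_le_mult_iff)
  also have "\<dots> \<le> k * partition_fn M (\<lambda>x. - g x)"
    using ln_le_minus_one[OF partition_fn_pos[OF g(2)]] k by (intro mult_left_mono) auto
  finally show ?thesis .
qed

text \<open>
  The Hellinger affinity \<open>B\<close> of the two tilts is explicit in the logarithm \<open>f\<close> of the partition
  function. Convexity of \<open>f\<close> along \<open>0 < 1 - e < 1\<close> and along \<open>1 - e/2 < 1 < 2\<close> bounds \<open>1 - B\<close> linearly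
  in \<open>e\<close>. The factorisation \<open>p - q = (\<surd>p - \<surd>q) (\<surd>p + \<surd>q)\<close> turns this into an \<open>L\<^sup>1\<close> bound; the
  inequality of arithmetic and geometric means with the free parameter \<open>t\<close> takes the place of
  Cauchy-Schwarz and keeps the right-hand side linear in \<open>f\<close>, ready for taking expectations.
\<close>

lemma tilt_rescaling:
  assumes h: "integrable M (\<lambda>x. exp (h x))" and h2: "integrable M (\<lambda>x. exp (2 * h x))"
    and [measurable]: "h \<in> borel_measurable M" and e: "0 \<le> e" "e \<le> 1" and t: "t > 0"
  shows "integrable M (\<lambda>x. exp ((1 - e) * h x))"
    and "(\<integral>x. \<bar>tilt M h x - tilt M (\<lambda>x. (1 - e) * h x) x\<bar> \<partial>M)
      \<le> 2 * t + e / (2 * t) * (ln (partition_fn M (\<lambda>x. 2 * h x)) - 2 * ln (partition_fn M h))"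
proof -
  define f where "f s = ln (partition_fn M (\<lambda>x. s * h x))" for s
  have one: "integrable M (\<lambda>x. exp ((0::real)))" by simp
  have he: "integrable M (\<lambda>x. exp ((1 - e) * h x))" 
    using log_partition_convex(1)[OF h one, of "1 - e"] e by simp
  then show "integrable M (\<lambda>x. exp ((1 - e) * h x))" .
  have hm: "integrable M (\<lambda>x. exp ((1 - e / 2) * h x))"
    using log_partition_convex(1)[OF h one, of "1 - e / 2"] e by simp
  have f1: "f (1 - e) \<le> (1 - e) * f 1"
    using log_partition_convex(2)[OF h one, of "1 - e"] e by (simp add: f_def)
  \<comment> \<open>The weight that makes 1 the convex combination of 1 - e/2 and 2.\<close>
  define l where "l = 1 / (1 + e / 2)"
  have l: "0 \<le> l" "l \<le> 1" "l > 0" and le: "l * (1 + e / 2) = 1" using e by (auto simp: l_def)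
  have "l * ((1 - e / 2) * s) + (1 - l) * (2 * s) = 2 * s - l * (1 + e / 2) * s" for s
    by (simp add: algebra_simps)
  then have "l * ((1 - e / 2) * s) + (1 - l) * (2 * s) = s" for s
    unfolding le by simp
  then have "f 1 \<le> l * f (1 - e / 2) + (1 - l) * f 2"
    using log_partition_convex(2)[OF hm h2 _ _ l(1,2)] by (simp add: f_def)
  then have "(1 + e / 2) * f 1 \<le> (1 + e / 2) * (l * f (1 - e / 2) + (1 - l) * f 2)"
    using e by (intro mult_left_mono) auto
  also have "\<dots> = (l * (1 + e / 2)) * f (1 - e / 2) + (1 + e / 2 - (l * (1 + e / 2))) * f 2"
    by (simp add: algebra_simps)
  also have "\<dots> = f (1 - e / 2) + e / 2 * f 2" unfolding le by simp
  finally have f2: "(1 + e / 2) * f 1 \<le> f (1 - e / 2) + e / 2 * f 2" .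
  define B where "B = exp (f (1 - e / 2) - f 1 / 2 - f (1 - e) / 2)"
  have "f 1 / 2 + f (1 - e) / 2 - f (1 - e / 2) \<le> e / 2 * (f 2 - 2 * f 1)"
    using f1 f2 by (simp add: field_simps)
  moreover have "1 - B \<le> f 1 / 2 + f (1 - e) / 2 - f (1 - e / 2)"
    unfolding B_def using exp_ge_add_one_self[of "f (1 - e / 2) - f 1 / 2 - f (1 - e) / 2"] by linarith
  ultimately have B: "1 - B \<le> e / 2 * (f 2 - 2 * f 1)" by linarith
  define p where "p = tilt M h"
  define q where "q = tilt M (\<lambda>x. (1 - e) * h x)"
  note P = tilt_density[OF h, folded p_def] tilt_nonneg[of h, folded p_def]
  note Q = tilt_density[OF he, folded q_def] tilt_nonneg[of "\<lambda>x. (1 - e) * h x", folded q_def]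
  have Z: "exp (f 1) = partition_fn M h" "exp (f (1 - e)) = partition_fn M (\<lambda>x. (1 - e) * h x)"
    "exp (f (1 - e / 2)) = partition_fn M (\<lambda>x. (1 - e / 2) * h x)"
    using partition_fn_pos[OF h] partition_fn_pos[OF he] partition_fn_pos[OF hm] by (auto simp: f_def)
  have sq: "sqrt (exp s) = exp (s / 2)" for s :: real
    by (rule real_sqrt_unique) (auto simp: power2_eq_square simp flip: exp_add)
  have pq: "sqrt (p x) * sqrt (q x) = exp (- f 1 / 2 - f (1 - e) / 2) * exp ((1 - e / 2) * h x)" for x
    unfolding p_def q_def tilt_def Z[symmetric] exp_diff[symmetric] sq exp_add[symmetric]
    by (simp add: field_simps)
  have pqi: "integrable M (\<lambda>x. sqrt (p x) * sqrt (q x))" unfolding pq using hm by auto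
  have "(\<integral>x. sqrt (p x) * sqrt (q x) \<partial>M) = exp (- f 1 / 2 - f (1 - e) / 2) * exp (f (1 - e / 2))"
    unfolding pq Z(3) partition_fn_def by simp
  also have "\<dots> = B" by (simp add: B_def algebra_simps flip: exp_add)
  finally have BC: "(\<integral>x. sqrt (p x) * sqrt (q x) \<partial>M) = B" .
  have pw: "\<bar>p x - q x\<bar> \<le> 1 / (2 * t) * (p x + q x - 2 * (sqrt (p x) * sqrt (q x))) + t * (p x + q x)" for x
  proof -
    define a b where "a = sqrt (p x)" and "b = sqrt (q x)"
    have ab: "p x = a\<^sup>2" "q x = b\<^sup>2" "a \<ge> 0" "b \<ge> 0" using P(3) Q(3) by (auto simp: a_def b_def)
    have "0 \<le> (\<bar>a - b\<bar> - t * (a + b))\<^sup>2" by simp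
    then have "2 * t * (\<bar>a - b\<bar> * (a + b)) \<le> (a - b)\<^sup>2 + t\<^sup>2 * (a + b)\<^sup>2"
      by (simp add: power2_diff[of "\<bar>a - b\<bar>"] power_mult_distrib[of t "a + b"]) (simp add: algebra_simps)
    also have "(a + b)\<^sup>2 \<le> 2 * (a\<^sup>2 + b\<^sup>2)"
      using zero_le_power2[of "a - b"] by (simp add: power2_eq_square algebra_simps)
    finally have "2 * t * (\<bar>a - b\<bar> * (a + b)) \<le> (a - b)\<^sup>2 + t\<^sup>2 * (2 * (a\<^sup>2 + b\<^sup>2))"
      by (simp add: mult_left_mono)
    moreover have "\<bar>p x - q x\<bar> = \<bar>a - b\<bar> * (a + b)"
    proof -
      have "p x - q x = (a - b) * (a + b)" unfolding ab by (simp add: power2_eq_square algebra_simps)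
      then show ?thesis using ab by (simp add: abs_mult)
    qed
    ultimately have "\<bar>p x - q x\<bar> * (2 * t) \<le> (a - b)\<^sup>2 + t\<^sup>2 * (2 * (p x + q x))"
      unfolding ab by (simp add: mult.commute)
    then have "\<bar>p x - q x\<bar> \<le> ((a - b)\<^sup>2 + t\<^sup>2 * (2 * (p x + q x))) / (2 * t)"
      using t by (simp add: field_simps)
    also have "\<dots> = 1 / (2 * t) * (a - b)\<^sup>2 + t * (p x + q x)"
      using t by (simp add: field_simps power2_eq_square)
    also have "(a - b)\<^sup>2 = p x + q x - 2 * (sqrt (p x) * sqrt (q x))"
      unfolding a_def[symmetric] b_def[symmetric] unfolding ab by (simp add: power2_diff)
    finally show ?thesis .
  qed
  have "(\<integral>x. \<bar>p x - q x\<bar> \<partial>M) \<le> (\<integral>x. 1 / (2 * t) * (p x + q x - 2 * (sqrt (p x) * sqrt (q x))) + t * (p x + q x) \<partial>M)"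
    using P Q pqi pw by (intro integral_mono) auto
  also have "\<dots> = 1 / (2 * t) * (1 + 1 - 2 * B) + t * (1 + 1)"
    using P Q pqi by (simp add: BC)
  also have "\<dots> = 2 * t + 1 / t * (1 - B)" using t by (simp add: field_simps)
  also have "\<dots> \<le> 2 * t + 1 / t * (e / 2 * (f 2 - 2 * f 1))"
    using B t by (intro add_left_mono mult_left_mono) auto
  finally show "(\<integral>x. \<bar>tilt M h x - tilt M (\<lambda>x. (1 - e) * h x) x\<bar> \<partial>M)
      \<le> 2 * t + e / (2 * t) * (ln (partition_fn M (\<lambda>x. 2 * h x)) - 2 * ln (partition_fn M h))"
    by (simp add: p_def q_def f_def)
qed

end

section \<open>The Gaussian Hamiltonian\<close>

lemma nn_integral_exp_std_normal:
  assumes "distributed M lborel X (\<lambda>x. ennreal (std_normal_density x))"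
  shows "(\<integral>\<^sup>+\<omega>. ennreal (exp (t * X \<omega>)) \<partial>M) = ennreal (exp (t\<^sup>2 / 2))"
proof -
  have shift: "std_normal_density x * exp (t * x) = exp (t\<^sup>2 / 2) * normal_density t 1 x" for x
  proof -
    have "- x\<^sup>2 / 2 + t * x = t\<^sup>2 / 2 + - (x - t)\<^sup>2 / 2"
      by (simp add: power2_eq_square field_simps)
    then show ?thesis
      unfolding normal_density_def by (simp flip: exp_add)
  qed
  have "(\<integral>\<^sup>+\<omega>. ennreal (exp (t * X \<omega>)) \<partial>M) = (\<integral>\<^sup>+x. ennreal (std_normal_density x) * ennreal (exp (t * x)) \<partial>lborel)"
    by (subst distributed_nn_integral[OF assms]) auto
  also have "\<dots> = (\<integral>\<^sup>+x. ennreal (exp (t\<^sup>2 / 2) * normal_density t 1 x) \<partial>lborel)"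
    by (simp add: shift flip: ennreal_mult)
  also have "\<dots> = ennreal (exp (t\<^sup>2 / 2))"
    by (subst nn_integral_eq_integral) auto
  finally show ?thesis .
qed

lemma (in prob_space) nn_integral_exp_sum_std_normal:
  fixes X :: "'i \<Rightarrow> 'a \<Rightarrow> real"
  assumes K: "finite K" and indep: "indep_vars (\<lambda>_. borel) X K"
    and normal: "\<And>i. i \<in> K \<Longrightarrow> distributed M lborel (X i) (\<lambda>x. ennreal (std_normal_density x))"
  shows "(\<integral>\<^sup>+\<omega>. ennreal (exp (\<Sum>i\<in>K. c i * X i \<omega>)) \<partial>M) = ennreal (exp ((\<Sum>i\<in>K. (c i)\<^sup>2) / 2))"
proof -
  have "indep_vars (\<lambda>_. borel) (\<lambda>i \<omega>. ennreal (exp (c i * X i \<omega>))) K"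
    by (rule indep_vars_compose2[OF indep]) simp
  then have "(\<integral>\<^sup>+\<omega>. (\<Prod>i\<in>K. ennreal (exp (c i * X i \<omega>))) \<partial>M) = (\<Prod>i\<in>K. \<integral>\<^sup>+\<omega>. ennreal (exp (c i * X i \<omega>)) \<partial>M)"
    using K by (intro indep_vars_nn_integral) auto
  also have "\<dots> = (\<Prod>i\<in>K. ennreal (exp ((c i)\<^sup>2 / 2)))"
    by (intro prod.cong refl nn_integral_exp_std_normal normal)
  also have "\<dots> = ennreal (exp ((\<Sum>i\<in>K. (c i)\<^sup>2) / 2))"
    by (simp add: prod_ennreal exp_sum[OF K] sum_divide_distrib)
  finally show ?thesis
    by (simp add: prod_ennreal exp_sum[OF K])
qed

lemma multi_indices_0: "multi_indices N 0 = {[]}"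
  by (auto simp: multi_indices_def)

lemma multi_indices_Suc: "multi_indices N (Suc p) = (\<lambda>(i, I). i # I) ` ({..<N} \<times> multi_indices N p)"
  by (force simp: multi_indices_def length_Suc_conv image_iff)

lemma finite_multi_indices [simp]: "finite (multi_indices N p)"
  by (induction p) (auto simp: multi_indices_0 multi_indices_Suc)

text \<open>
  The squared norm of the tensor power of order \<open>p\<close>.
\<close>

lemma sum_prod_list_squared:
  "(\<Sum>I\<in>multi_indices N p. (prod_list (map \<sigma> I))\<^sup>2) = (sqnorm N \<sigma>) ^ p"
proof (induction p)
  case (Suc p)
  have "(\<Sum>I\<in>multi_indices N (Suc p). (prod_list (map \<sigma> I))\<^sup>2) =
     (\<Sum>(i, I)\<in>{..<N} \<times> multi_indices N p. (\<sigma> i)\<^sup>2 * (prod_list (map \<sigma> I))\<^sup>2)"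
    unfolding multi_indices_Suc by (subst sum.reindex) (auto simp: inj_on_def power_mult_distrib intro!: sum.cong)
  also have "\<dots> = sqnorm N \<sigma> * sqnorm N \<sigma> ^ p"
    unfolding Suc.IH[symmetric] by (simp add: sqnorm_def sum_product sum.cartesian_product)
  finally show ?case by simp
qed (simp add: multi_indices_0)

definition spin_coeff :: "(nat \<Rightarrow> real) \<Rightarrow> nat \<Rightarrow> (nat \<Rightarrow> real) \<Rightarrow> nat \<Rightarrow> nat list \<Rightarrow> real" where
  "spin_coeff \<gamma> N \<sigma> p I = \<gamma> p * real N powr (- (real p - 1) / 2) * prod_list (map \<sigma> I)"

definition spin_term :: "(nat \<Rightarrow> real) \<Rightarrow> nat \<Rightarrow> disorder \<Rightarrow> (nat \<Rightarrow> real) \<Rightarrow> nat \<Rightarrow> real" where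
  "spin_term \<gamma> N g \<sigma> p = (if p = 0 then 0 else \<Sum>I\<in>multi_indices N p. spin_coeff \<gamma> N \<sigma> p I * g p I)"

text \<open>
  The coefficients of the power series \<open>\<xi>\<close>, so that \<open>suminf (spin_var \<gamma>)\<close> is \<open>\<xi>(1)\<close>.
\<close>

definition spin_var :: "(nat \<Rightarrow> real) \<Rightarrow> nat \<Rightarrow> real" where
  "spin_var \<gamma> p = (if p = 0 then 0 else (\<gamma> p)\<^sup>2)"

lemma hamiltonian_eq_suminf: "hamiltonian \<gamma> N g \<sigma> = (\<Sum>p. spin_term \<gamma> N g \<sigma> p)"
  unfolding hamiltonian_def spin_term_def spin_coeff_def tensor_form_def
  by (intro suminf_cong) (auto simp: sum_distrib_left mult_ac)

text \<open>
  On the sphere the squared norm of the tensor power is \<open>N ^ p\<close>, and the normalisation of the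
  Hamiltonian reduces it to \<open>N\<close> for every \<open>p\<close>.
\<close>

lemma sum_spin_coeff_squared:
  assumes N: "N \<ge> 1" and \<sigma>: "sqnorm N \<sigma> = N"
  shows "(\<Sum>I\<in>multi_indices N p. (spin_coeff \<gamma> N \<sigma> p I)\<^sup>2) = real N * (\<gamma> p)\<^sup>2"
proof -
  have "(\<Sum>I\<in>multi_indices N p. (spin_coeff \<gamma> N \<sigma> p I)\<^sup>2) = (\<gamma> p)\<^sup>2 * ((real N powr (- (real p - 1) / 2))\<^sup>2 * real N ^ p)"
    unfolding spin_coeff_def power_mult_distrib sum_distrib_left[symmetric] sum_prod_list_squared \<sigma> mult.assoc ..
  also have "(real N powr (- (real p - 1) / 2))\<^sup>2 * real N ^ p
      = real N powr (- (real p - 1) / 2 + - (real p - 1) / 2 + real p)"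
    using N by (simp only: powr_add powr_realpow power2_eq_square)
  also have "- (real p - 1) / 2 + - (real p - 1) / 2 + real p = 1" by (simp add: field_simps)
  finally show ?thesis using N by simp
qed

lemma measurable_spin_term:
  assumes [measurable]: "\<And>p I. p \<ge> 1 \<Longrightarrow> I \<in> multi_indices N p \<Longrightarrow> (\<lambda>x. g x p I) \<in> borel_measurable X"
  shows "(\<lambda>z. spin_term \<gamma> N (g (fst z)) (snd z) p) \<in> borel_measurable (X \<Otimes>\<^sub>M Rn N)"
proof -
  have "(\<lambda>\<sigma>. prod_list (map \<sigma> I)) \<in> borel_measurable (Rn N)" if "set I \<subseteq> {..<N}" for I
    using that by (induction I) auto
  then have [measurable]: "(\<lambda>\<sigma>. prod_list (map \<sigma> I)) \<in> borel_measurable (Rn N)" if "I \<in> multi_indices N p" for I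
    using that by (auto simp: multi_indices_def)
  show ?thesis
  proof (cases "p = 0")
    case False
    then show ?thesis unfolding spin_term_def spin_coeff_def 
      by (auto intro!: borel_measurable_sum borel_measurable_times measurable_compose[OF measurable_fst] measurable_compose[OF measurable_snd] borel_measurable_const)
  qed (simp add: spin_term_def)
qed

lemma measurable_hamiltonian:
  assumes "\<And>p I. p \<ge> 1 \<Longrightarrow> I \<in> multi_indices N p \<Longrightarrow> (\<lambda>x. g x p I) \<in> borel_measurable X"
  shows "(\<lambda>z. hamiltonian \<gamma> N (g (fst z)) (snd z)) \<in> borel_measurable (X \<Otimes>\<^sub>M Rn N)"
  unfolding hamiltonian_eq_suminf by (intro borel_measurable_suminf measurable_spin_term assms)

text \<open>
  With \<open>t\<close> of the order of an inverse standard deviation, this yields first absolute moments from exponential moments.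
\<close>

lemma abs_le_exp_sum: "t > 0 \<Longrightarrow> \<bar>x\<bar> \<le> (exp (t * x) + exp (- (t * x))) / (t :: real)"
proof -
  assume t: "t > 0"
  have "\<bar>t * x\<bar> \<le> exp (t * x) + exp (- (t * x))"
    using exp_ge_add_one_self[of "t * x"] exp_ge_add_one_self[of "- (t * x)"] 
      exp_gt_zero[of "t * x"] exp_gt_zero[of "- (t * x)"] by linarith
  then show ?thesis using t by (simp add: abs_mult field_simps)
qed

lemma measurable_hamiltonian_fixed [measurable]: "hamiltonian \<gamma> N g \<in> borel_measurable (Rn N)"
  using measurable_compose[OF measurable_Pair1' measurable_hamiltonian[of N "\<lambda>_. g" "count_space {()}" \<gamma>], of "()"] by simp

lemma hamiltonian_cong:
  assumes "\<And>p I. p \<ge> 1 \<Longrightarrow> I \<in> multi_indices N p \<Longrightarrow> g p I = g' p I"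
  shows "hamiltonian \<gamma> N g = hamiltonian \<gamma> N g'"
  using assms by (intro ext) (auto simp: hamiltonian_eq_suminf spin_term_def intro!: suminf_cong sum.cong)

lemma hamiltonian_correlate:
  assumes "summable (spin_term \<gamma> N g \<sigma>)" "summable (spin_term \<gamma> N w \<sigma>)"
  shows "hamiltonian \<gamma> N (correlate e g w) \<sigma>
     = (1 - e) * hamiltonian \<gamma> N g \<sigma> + sqrt (2 * e - e\<^sup>2) * hamiltonian \<gamma> N w \<sigma>"
proof -
  have "spin_term \<gamma> N (correlate e g w) \<sigma> p
      = (1 - e) * spin_term \<gamma> N g \<sigma> p + sqrt (2 * e - e\<^sup>2) * spin_term \<gamma> N w \<sigma> p" for p
    by (simp add: spin_term_def correlate_def sum_distrib_left sum.distrib[symmetric] algebra_simps)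
  then show ?thesis
    using assms by (simp add: hamiltonian_eq_suminf suminf_mult suminf_add[symmetric] summable_mult)
qed

text \<open>
  The disorder and its independent copy are given as one independent family; the label \<open>b\<close> selects
  one of them inside the family \<open>X\<close>.
\<close>

locale gaussian_disorder = prob_space +
  fixes N :: nat and g :: "'a \<Rightarrow> disorder" and X :: "'l \<times> nat \<times> nat list \<Rightarrow> 'a \<Rightarrow> real" and b :: 'l
  assumes N: "N \<ge> 1"
    and indep: "indep_vars (\<lambda>_. borel) X ({b} \<times> (SIGMA p:{1..}. multi_indices N p))"
    and normal: "\<And>p I. p \<ge> 1 \<Longrightarrow> I \<in> multi_indices N p \<Longrightarrow>
      distributed M lborel (X (b, p, I)) (\<lambda>x. ennreal (std_normal_density x))"
    and g: "\<And>\<omega> p I. g \<omega> p I = X (b, p, I) \<omega>"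
begin

lemma measurable_entry: "p \<ge> 1 \<Longrightarrow> I \<in> multi_indices N p \<Longrightarrow> (\<lambda>\<omega>. g \<omega> p I) \<in> borel_measurable M"
  using distributed_measurable[OF normal] by (simp add: g[abs_def])

lemmas measurable_spin_term_joint [measurable] = measurable_spin_term[OF measurable_entry]
lemmas measurable_hamiltonian_joint [measurable] = measurable_hamiltonian[OF measurable_entry]

lemma measurable_spin_term_section: "\<sigma> \<in> space (Rn N) \<Longrightarrow> (\<lambda>\<omega>. spin_term \<gamma> N (g \<omega>) \<sigma> p) \<in> borel_measurable M"
  using measurable_compose[OF measurable_Pair2' measurable_spin_term_joint] by simp

text \<open>
  A finite part of the Hamiltonian is a linear combination of finitely many independent standard
  Gaussians, whose exponential moments multiply.
\<close>

lemma partial_sum_mgf: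
  assumes \<sigma>: "sqnorm N \<sigma> = N" and A: "finite A"
  shows "(\<integral>\<^sup>+\<omega>. ennreal (exp (t * (\<Sum>p\<in>A. spin_term \<gamma> N (g \<omega>) \<sigma> p))) \<partial>M)
     = ennreal (exp (t\<^sup>2 * N * (\<Sum>p\<in>A. spin_var \<gamma> p) / 2))"
proof -
  define K where "K = {b} \<times> (SIGMA p:A - {0}. multi_indices N p)"
  have K: "finite K" "K \<subseteq> {b} \<times> (SIGMA p:{1..}. multi_indices N p)"
    using A by (auto simp: K_def)
  have sumK: "(\<Sum>i\<in>K. f (fst (snd i)) (snd (snd i))) = (\<Sum>p\<in>A - {0}. \<Sum>I\<in>multi_indices N p. f p I)" for f :: "nat \<Rightarrow> nat list \<Rightarrow> real"
  proof -
    have "K = Pair b ` (SIGMA p:A - {0}. multi_indices N p)" by (auto simp: K_def)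
    then show ?thesis using A by (simp add: sum.reindex inj_on_def sum.Sigma case_prod_beta)
  qed
  define c where "c i = t * spin_coeff \<gamma> N \<sigma> (fst (snd i)) (snd (snd i))" for i :: "'l \<times> nat \<times> nat list"
  have eq: "t * (\<Sum>p\<in>A. spin_term \<gamma> N (g \<omega>) \<sigma> p) = (\<Sum>i\<in>K. c i * X i \<omega>)" for \<omega>
  proof -
    have "(\<Sum>p\<in>A. spin_term \<gamma> N (g \<omega>) \<sigma> p) = (\<Sum>p\<in>A - {0}. spin_term \<gamma> N (g \<omega>) \<sigma> p)"
      using A by (intro sum.mono_neutral_right) (auto simp: spin_term_def)
    also have "t * \<dots> = (\<Sum>p\<in>A - {0}. \<Sum>I\<in>multi_indices N p. t * (spin_coeff \<gamma> N \<sigma> p I * g \<omega> p I))"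
      by (auto simp: spin_term_def sum_distrib_left intro!: sum.cong)
    also have "\<dots> = (\<Sum>i\<in>K. t * (spin_coeff \<gamma> N \<sigma> (fst (snd i)) (snd (snd i)) * g \<omega> (fst (snd i)) (snd (snd i))))"
      by (rule sumK[symmetric])
    also have "\<dots> = (\<Sum>i\<in>K. c i * X i \<omega>)"
      by (rule sum.cong) (auto simp: K_def c_def g)
    finally show ?thesis .
  qed
  have "(\<Sum>i\<in>K. (c i)\<^sup>2) = (\<Sum>p\<in>A - {0}. \<Sum>I\<in>multi_indices N p. (t * spin_coeff \<gamma> N \<sigma> p I)\<^sup>2)"
    unfolding c_def by (rule sumK)
  also have "\<dots> = t\<^sup>2 * N * (\<Sum>p\<in>A - {0}. spin_var \<gamma> p)"
    unfolding power_mult_distrib sum_distrib_left[symmetric] sum_spin_coeff_squared[OF N \<sigma>]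
    by (simp add: sum_distrib_left[symmetric] spin_var_def)
  also have "(\<Sum>p\<in>A - {0}. spin_var \<gamma> p) = (\<Sum>p\<in>A. spin_var \<gamma> p)"
    using A by (intro sum.mono_neutral_left) (auto simp: spin_var_def)
  finally have var: "(\<Sum>i\<in>K. (c i)\<^sup>2) = t\<^sup>2 * N * (\<Sum>p\<in>A. spin_var \<gamma> p)" .
  show ?thesis unfolding eq var[symmetric]
    by (rule nn_integral_exp_sum_std_normal[OF K(1) indep_vars_subset[OF indep K(2)]]) (auto simp: K_def intro!: normal)
qed

text \<open>
  The term of order \<open>p\<close> has standard deviation \<open>\<gamma> p * sqrt N\<close>, the inverse of the parameter \<open>t\<close> at
  which the exponential moment is taken.
\<close>

lemma spin_term_abs_moment:
  assumes \<sigma>: "sqnorm N \<sigma> = N" "\<sigma> \<in> space (Rn N)" and \<gamma>: "\<gamma> p \<ge> 0 \<or> p = 0"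
  shows "(\<integral>\<^sup>+\<omega>. ennreal \<bar>spin_term \<gamma> N (g \<omega>) \<sigma> p\<bar> \<partial>M) \<le> ennreal (2 * exp (1 / 2) * sqrt N * (if p = 0 then 0 else \<gamma> p))"
proof (cases "p = 0 \<or> \<gamma> p = 0")
  case True
  then show ?thesis by (auto simp: spin_term_def spin_coeff_def)
next
  case False
  then have pos: "\<gamma> p > 0" "p \<noteq> 0" using \<gamma> by auto
  note [measurable] = measurable_spin_term_section[OF \<sigma>(2)]
  define t where "t = 1 / (\<gamma> p * sqrt N)"
  have t: "t > 0" "t\<^sup>2 * N * (\<gamma> p)\<^sup>2 = 1" using pos N by (auto simp: t_def power_divide power_mult_distrib)
  have mgf: "(\<integral>\<^sup>+\<omega>. ennreal (exp (s * spin_term \<gamma> N (g \<omega>) \<sigma> p)) \<partial>M) = ennreal (exp (1 / 2))" if "s\<^sup>2 = t\<^sup>2" for s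
    using partial_sum_mgf[OF \<sigma>(1), of "{p}" s \<gamma>] t(2) pos that by (simp add: spin_var_def)
  have "(\<integral>\<^sup>+\<omega>. ennreal \<bar>spin_term \<gamma> N (g \<omega>) \<sigma> p\<bar> \<partial>M)
     \<le> (\<integral>\<^sup>+\<omega>. ennreal (1 / t) * (ennreal (exp (t * spin_term \<gamma> N (g \<omega>) \<sigma> p)) + ennreal (exp ((- t) * spin_term \<gamma> N (g \<omega>) \<sigma> p))) \<partial>M)"
    using abs_le_exp_sum[OF t(1)] t(1)
    by (intro nn_integral_mono) (auto simp flip: ennreal_plus ennreal_mult intro!: ennreal_leI)
  also have "\<dots> = ennreal (1 / t) * (ennreal (exp (1 / 2)) + ennreal (exp (1 / 2)))"
    by (subst nn_integral_cmult, simp, subst nn_integral_add) (simp_all add: mgf[simplified] mgf[of "- t", simplified])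
  also have "\<dots> = ennreal (2 * exp (1 / 2) * sqrt N * \<gamma> p)"
    using t(1) by (simp add: t_def mult_ac flip: ennreal_plus ennreal_mult)
  finally show ?thesis using pos by simp
qed

end

lemma summable_spin_term:
  "(\<Sum>p. ennreal \<bar>spin_term \<gamma> N g \<sigma> p\<bar>) \<noteq> \<top> \<Longrightarrow> summable (spin_term \<gamma> N g \<sigma>)"
  by (rule summable_rabs_cancel, rule summable_suminf_not_top) auto

text \<open>
  The terms of the Hamiltonian are compared in \<open>L\<^sup>1\<close>, which requires \<open>\<gamma>\<close> itself to be summable. This
  is where a radius strictly beyond \<open>1\<close> matters: for \<open>1 < r\<close> inside the disc of convergence,
  \<open>2 \<gamma> p \<le> (\<gamma> p)\<^sup>2 r ^ p + r ^ (- p)\<close>.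
\<close>

lemma summable_coefficients:
  fixes \<gamma> :: "nat \<Rightarrow> real"
  assumes gamma_nonneg: "\<And>p. p \<ge> 1 \<Longrightarrow> \<gamma> p \<ge> 0" and xi_radius: "conv_radius (\<lambda>p. (\<gamma> p)\<^sup>2) > 1"
  shows "summable (spin_var \<gamma>)" "summable (\<lambda>p. if p = 0 then 0 else \<gamma> p)"
proof -
  obtain r where r: "1 < ereal r" "ereal r < conv_radius (\<lambda>p. (\<gamma> p)\<^sup>2)"
    using ereal_dense2[OF xi_radius] by auto
  have r1: "r > 1" using r(1) by simp
  have "summable (\<lambda>p. (\<gamma> p)\<^sup>2 * 1 ^ p)"
    by (rule summable_in_conv_radius) (use xi_radius in \<open>simp add: one_ereal_def\<close>)
  then have "summable (\<lambda>p. (\<gamma> p)\<^sup>2)" by simp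
  then show "summable (spin_var \<gamma>)"
    by (rule summable_comparison_test'[where N=1]) (simp add: spin_var_def)
  have s: "summable (\<lambda>p. (\<gamma> p)\<^sup>2 * r ^ p + (1 / r) ^ p)"
    using r1 r(2) by (intro summable_add summable_in_conv_radius summable_geometric) auto
  show "summable (\<lambda>p. if p = 0 then 0 else \<gamma> p)"
  proof (rule summable_comparison_test'[OF s, where N=1])
    fix p :: nat assume p: "p \<ge> 1"
    define a where "a = sqrt (r ^ p)"
    have a: "a > 0" "r ^ p = a\<^sup>2" using r1 by (auto simp: a_def)
    have "0 \<le> (\<gamma> p * a - 1 / a)\<^sup>2" by simp
    then have "2 * \<gamma> p \<le> (\<gamma> p)\<^sup>2 * a\<^sup>2 + 1 / a\<^sup>2"
      using a(1) by (simp add: power2_diff power_mult_distrib power_divide)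
    then show "norm (if p = 0 then 0 else \<gamma> p) \<le> (\<gamma> p)\<^sup>2 * r ^ p + (1 / r) ^ p"
      using p gamma_nonneg[OF p] by (simp add: power_one_over a(2))
  qed
qed

context gaussian_disorder
begin

context
  fixes \<gamma> :: "nat \<Rightarrow> real"
  assumes gamma_nonneg: "\<And>p. p \<ge> 1 \<Longrightarrow> \<gamma> p \<ge> 0" and xi_radius: "conv_radius (\<lambda>p. (\<gamma> p)\<^sup>2) > 1"
begin

text \<open>
  The first absolute moments of the terms are summable, so the series converges absolutely for almost
  every disorder. The exceptional set depends on \<open>\<sigma>\<close>; absolute convergence is stated through an
  extended real sum because the latter is visibly measurable in the disorder and \<open>\<sigma>\<close> jointly, as
  exchanging the two quantifiers requires.
\<close>

lemma AE_spin_series_finite: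
  assumes \<sigma>: "sqnorm N \<sigma> = N" "\<sigma> \<in> space (Rn N)"
  shows "AE \<omega> in M. (\<Sum>p. ennreal \<bar>spin_term \<gamma> N (g \<omega>) \<sigma> p\<bar>) \<noteq> \<top>"
proof -
  note [measurable] = measurable_spin_term_section[OF \<sigma>(2)]
  define v where "v p = 2 * exp (1 / 2) * sqrt N * (if p = 0 then 0 else \<gamma> p)" for p
  have v: "summable v" "\<And>p. v p \<ge> 0" unfolding v_def
    using summable_coefficients[OF gamma_nonneg xi_radius] gamma_nonneg by (auto intro!: summable_mult mult_nonneg_nonneg)
  have "(\<integral>\<^sup>+\<omega>. (\<Sum>p. ennreal \<bar>spin_term \<gamma> N (g \<omega>) \<sigma> p\<bar>) \<partial>M) = (\<Sum>p. \<integral>\<^sup>+\<omega>. ennreal \<bar>spin_term \<gamma> N (g \<omega>) \<sigma> p\<bar> \<partial>M)"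
    by (rule nn_integral_suminf) simp
  also have "\<dots> \<le> (\<Sum>p. ennreal (v p))"
    unfolding v_def using gamma_nonneg by (intro suminf_le spin_term_abs_moment \<sigma>) (auto simp: not_less_eq_eq)
  also have "\<dots> < \<infinity>" using v by (simp add: suminf_ennreal2 less_top)
  finally show ?thesis
    by (intro nn_integral_PInf_AE[unfolded infinity_ennreal_def]) (auto simp: less_top)
qed

text \<open>
  Fatou's lemma along the partial sums.
\<close>

lemma hamiltonian_mgf:
  assumes \<sigma>: "sqnorm N \<sigma> = N" "\<sigma> \<in> space (Rn N)"
  shows "(\<integral>\<^sup>+\<omega>. ennreal (exp (t * hamiltonian \<gamma> N (g \<omega>) \<sigma>)) \<partial>M) \<le> ennreal (exp (t\<^sup>2 * N * suminf (spin_var \<gamma>) / 2))"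
proof -
  note [measurable] = measurable_spin_term_section[OF \<sigma>(2)]
  define S where "S n \<omega> = (\<Sum>p<n. spin_term \<gamma> N (g \<omega>) \<sigma> p)" for n \<omega>
  have [measurable]: "S n \<in> borel_measurable M" for n unfolding S_def[abs_def] by measurable
  have "(\<integral>\<^sup>+\<omega>. ennreal (exp (t * hamiltonian \<gamma> N (g \<omega>) \<sigma>)) \<partial>M) = (\<integral>\<^sup>+\<omega>. liminf (\<lambda>n. ennreal (exp (t * S n \<omega>))) \<partial>M)"
    using AE_spin_series_finite[OF \<sigma>]
  proof (intro nn_integral_cong_AE, eventually_elim)
    fix \<omega> assume "(\<Sum>p. ennreal \<bar>spin_term \<gamma> N (g \<omega>) \<sigma> p\<bar>) \<noteq> \<top>"
    then have "summable (spin_term \<gamma> N (g \<omega>) \<sigma>)" by (rule summable_spin_term)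
    then have "(\<lambda>n. S n \<omega>) \<longlonglongrightarrow> hamiltonian \<gamma> N (g \<omega>) \<sigma>"
      unfolding S_def hamiltonian_eq_suminf by (rule summable_LIMSEQ)
    then have "(\<lambda>n. ennreal (exp (t * S n \<omega>))) \<longlonglongrightarrow> ennreal (exp (t * hamiltonian \<gamma> N (g \<omega>) \<sigma>))"
      by (intro tendsto_intros)
    then show "ennreal (exp (t * hamiltonian \<gamma> N (g \<omega>) \<sigma>)) = liminf (\<lambda>n. ennreal (exp (t * S n \<omega>)))"
      by (intro lim_imp_Liminf[symmetric]) auto
  qed
  also have "\<dots> \<le> liminf (\<lambda>n. \<integral>\<^sup>+\<omega>. ennreal (exp (t * S n \<omega>)) \<partial>M)"
    by (rule nn_integral_liminf) simp
  also have "\<dots> = liminf (\<lambda>n. ennreal (exp (t\<^sup>2 * N * (\<Sum>p<n. spin_var \<gamma> p) / 2)))"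
    unfolding S_def by (simp add: partial_sum_mgf[OF \<sigma>(1)])
  also have "\<dots> \<le> ennreal (exp (t\<^sup>2 * N * suminf (spin_var \<gamma>) / 2))"
  proof -
    have "(\<Sum>p<n. spin_var \<gamma> p) \<le> suminf (spin_var \<gamma>)" for n
      by (rule sum_le_suminf[OF summable_coefficients(1)[OF gamma_nonneg xi_radius]]) (auto simp: spin_var_def)
    then have "ennreal (exp (t\<^sup>2 * N * (\<Sum>p<n. spin_var \<gamma> p) / 2)) \<le> ennreal (exp (t\<^sup>2 * N * suminf (spin_var \<gamma>) / 2))" for n
      by (intro ennreal_leI) (auto intro!: divide_right_mono mult_left_mono)
    then show ?thesis by (intro Liminf_le) auto
  qed
  finally show ?thesis .
qed

end
end

section \<open>The reference measures\<close>

lemma cube_uniform_reference: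
  shows "prob_space (cube_uniform N)" "sets (cube_uniform N) = sets (Rn N)" "AE x in cube_uniform N. sqnorm N x = N"
proof -
  let ?A = "{..<N} \<rightarrow>\<^sub>E {-1, 1::real}"
  have A: "finite ?A" "?A \<noteq> {}" by (auto intro!: finite_PiE simp: PiE_eq_empty_iff)
  interpret prob_space "uniform_count_measure ?A" using A by (rule prob_space_uniform_count_measure)
  have m [measurable]: "(\<lambda>\<sigma>. \<sigma>) \<in> measurable (uniform_count_measure ?A) (Rn N)"
    by (rule measurableI) (auto simp: space_PiM space_uniform_count_measure sets_uniform_count_measure)
  show "prob_space (cube_uniform N)" unfolding cube_uniform_def by (rule prob_space_distr) simp
  show "sets (cube_uniform N) = sets (Rn N)" by (simp add: cube_uniform_def)
  have "sqnorm N x = N" if "x \<in> ?A" for x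
  proof -
    have "(x i)\<^sup>2 = 1" if "i < N" for i using PiE_mem[OF \<open>x \<in> ?A\<close>, of i] that by auto
    then show ?thesis by (simp add: sqnorm_def)
  qed
  then show "AE x in cube_uniform N. sqnorm N x = N" unfolding cube_uniform_def
    by (subst AE_distr_iff) (auto simp: space_uniform_count_measure intro!: AE_I2)
qed

text \<open>
  The radial projection ends on the sphere except at points of norm \<open>0\<close>. These have first coordinate
  \<open>0\<close> and hence form a null set.
\<close>

lemma sphere_uniform_reference:
  assumes N: "N \<ge> 1"
  shows "prob_space (sphere_uniform N)" "sets (sphere_uniform N) = sets (Rn N)" "AE x in sphere_uniform N. sqnorm N x = N"
proof -
  define L where "L = PiM {..<N} (\<lambda>_. lborel :: real measure)"
  define B where "B = {x \<in> space (Rn N). sqnorm N x \<le> 1}"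
  interpret product_sigma_finite "\<lambda>_::nat. lborel :: real measure" ..
  have sL [measurable_cong]: "sets L = sets (Rn N)" unfolding L_def by (intro sets_PiM_cong) auto
  have spL: "space L = space (Rn N)" by (rule sets_eq_imp_space_eq[OF sL])
  have Bm: "B \<in> sets L" unfolding B_def sL by measurable
  have box: "emeasure L ({..<N} \<rightarrow>\<^sub>E {-r..r}) = ennreal ((2 * r) ^ N)" if "r \<ge> 0" for r :: real
    unfolding L_def using that by (subst emeasure_PiM) (auto simp: ennreal_power)
  have "B \<subseteq> {..<N} \<rightarrow>\<^sub>E {-1..1}"
  proof
    fix x assume "x \<in> B"
    then have x: "x \<in> extensional {..<N}" "sqnorm N x \<le> 1" by (auto simp: B_def space_PiM PiE_def)
    have "\<bar>x i\<bar> \<le> 1" if "i < N" for i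
    proof -
      have "(x i)\<^sup>2 \<le> sqnorm N x" unfolding sqnorm_def using that by (intro member_le_sum) auto
      then show ?thesis using x(2) by (simp flip: abs_square_le_1)
    qed
    then show "x \<in> {..<N} \<rightarrow>\<^sub>E {-1..1}" using x(1) by (auto simp: PiE_iff abs_le_iff)
  qed
  then have "emeasure L B \<le> emeasure L ({..<N} \<rightarrow>\<^sub>E {-1..1})"
    by (intro emeasure_mono) (auto simp: sL intro!: sets_PiM_I_finite)
  then have fin: "emeasure L B < \<infinity>" using box[of 1] by (simp add: le_less_trans)
  \<comment> \<open>The unit ball lies between two boxes, so its volume is positive and finite.\<close>
  have "{..<N} \<rightarrow>\<^sub>E {-(1 / real N)..1 / real N} \<subseteq> B"
  proof
    fix x assume x: "x \<in> {..<N} \<rightarrow>\<^sub>E {-(1 / real N)..1 / real N}"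
    have "sqnorm N x \<le> (\<Sum>i<N. (1 / real N)\<^sup>2)" unfolding sqnorm_def
    proof (rule sum_mono)
      fix i assume "i \<in> {..<N}"
      then have "\<bar>x i\<bar> \<le> \<bar>1 / real N\<bar>" using PiE_mem[OF x, of i] by (auto simp: abs_le_iff)
      then show "(x i)\<^sup>2 \<le> (1 / real N)\<^sup>2" by (simp only: abs_le_square_iff)
    qed
    also have "\<dots> \<le> 1" using N by (simp add: power2_eq_square field_simps)
    finally show "x \<in> B" using x by (auto simp: B_def space_PiM PiE_iff)
  qed
  then have "emeasure L ({..<N} \<rightarrow>\<^sub>E {-(1 / real N)..1 / real N}) \<le> emeasure L B"
    by (intro emeasure_mono Bm)
  then have pos: "emeasure L B \<noteq> 0" using box[of "1 / real N"] N by auto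
  define U where "U = uniform_measure L B"
  define f where "f = (\<lambda>x. \<lambda>i\<in>{..<N}. sqrt (real N) * x i / sqrt (sqnorm N x))"
  have S: "sphere_uniform N = distr U (Rn N) f"
    by (simp add: sphere_uniform_def U_def L_def B_def f_def)
  interpret U: prob_space U unfolding U_def by (rule prob_space_uniform_measure) (use pos fin in auto)
  have [measurable_cong]: "sets U = sets (Rn N)" by (simp add: U_def sL)
  have [measurable]: "f \<in> measurable U (Rn N)" unfolding f_def by measurable
  show "prob_space (sphere_uniform N)" unfolding S by (rule U.prob_space_distr) simp
  show "sets (sphere_uniform N) = sets (Rn N)" by (simp add: S)
  have "AE x in L. x 0 \<noteq> 0"
  proof -
    let ?Y = "Pi\<^sub>E {..<N} (\<lambda>i. if i = 0 then {0::real} else UNIV)"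
    have "emeasure L ?Y = (\<Prod>i<N. emeasure lborel (if i = 0 then {0::real} else UNIV))"
      unfolding L_def by (subst emeasure_PiM) auto
    also have "\<dots> = 0" using N by (intro prod_zero bexI[of _ 0]) auto
    finally have "emeasure L ?Y = 0" .
    moreover have "?Y \<in> sets L" by (auto simp: L_def intro!: sets_PiM_I_finite)
    ultimately have "AE x in L. x \<notin> ?Y" by (intro AE_not_in) (auto simp: null_sets_def)
    with AE_space show ?thesis
      by eventually_elim (use N in \<open>auto simp: L_def space_PiM PiE_iff split: if_splits\<close>)
  qed
  then have "AE x in U. x 0 \<noteq> 0" unfolding U_def by (intro AE_uniform_measureI Bm) auto
  then have "AE x in U. sqnorm N (f x) = N"
  proof eventually_elim
    case (elim x)
    have "(x 0)\<^sup>2 \<le> sqnorm N x" unfolding sqnorm_def using N by (intro member_le_sum) auto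
    moreover have "(x 0)\<^sup>2 > 0" using elim by simp
    ultimately have s: "sqnorm N x > 0" by linarith
    have "sqnorm N (f x) = (\<Sum>i<N. real N / sqnorm N x * (x i)\<^sup>2)"
      unfolding sqnorm_def[of N "f x"] unfolding f_def using s
      by (intro sum.cong) (auto simp: power_divide power_mult_distrib)
    also have "\<dots> = real N / sqnorm N x * sqnorm N x" by (simp add: sqnorm_def[of N x] sum_distrib_left)
    finally show ?case using s by simp
  qed
  then show "AE x in sphere_uniform N. sqnorm N x = N"
    unfolding S by (subst AE_distr_iff) auto
qed

section \<open>Expected distance of the two Gibbs densities\<close>

text \<open>
  Tonelli's theorem in the form in which it serves below: a bound on the moments over \<open>P\<close>, averaged over
  \<open>Q\<close>, makes almost all integrals over \<open>Q\<close> finite and bounds their expectation.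
\<close>

lemma section_integrals_bound:
  fixes u :: "'a \<Rightarrow> 'b \<Rightarrow> real"
  assumes P: "prob_space P" and Q: "prob_space Q"
    and u [measurable]: "(\<lambda>z. u (fst z) (snd z)) \<in> borel_measurable (P \<Otimes>\<^sub>M Q)" and nn: "\<And>x y. u x y \<ge> 0"
    and le: "(\<integral>\<^sup>+y. \<integral>\<^sup>+x. ennreal (u x y) \<partial>P \<partial>Q) \<le> ennreal c" and c: "c \<ge> 0"
  shows "AE x in P. integrable Q (u x)"
    and "integrable P (\<lambda>x. \<integral>y. u x y \<partial>Q)"
    and "(\<integral>x. \<integral>y. u x y \<partial>Q \<partial>P) \<le> c"
proof -
  interpret p1: prob_space P by fact
  interpret p2: prob_space Q by fact
  interpret pair_sigma_finite P Q ..
  have le': "(\<integral>\<^sup>+z. ennreal (u (fst z) (snd z)) \<partial>(P \<Otimes>\<^sub>M Q)) \<le> ennreal c"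
    using le by (subst nn_integral_snd[symmetric]) (auto simp: case_prod_beta)
  have i: "integrable (P \<Otimes>\<^sub>M Q) (\<lambda>z. u (fst z) (snd z))"
    using nn le' by (intro integrableI_nonneg) (auto simp: le_less_trans)
  show "AE x in P. integrable Q (u x)" using AE_integrable_fst'[OF i] by simp
  show "integrable P (\<lambda>x. \<integral>y. u x y \<partial>Q)" using integrable_fst'[OF i] by simp
  have "(\<integral>x. \<integral>y. u x y \<partial>Q \<partial>P) = (\<integral>z. u (fst z) (snd z) \<partial>(P \<Otimes>\<^sub>M Q))"
    using integral_fst'[OF i] by simp
  also have "ennreal \<dots> = (\<integral>\<^sup>+z. ennreal (u (fst z) (snd z)) \<partial>(P \<Otimes>\<^sub>M Q))"
    using nn by (subst nn_integral_eq_integral[OF i]) auto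
  finally have "ennreal (\<integral>x. \<integral>y. u x y \<partial>Q \<partial>P) \<le> ennreal c" using le' by simp
  then show "(\<integral>x. \<integral>y. u x y \<partial>Q \<partial>P) \<le> c" using c by (simp only: ennreal_le_iff)
qed

lemma (in prob_space) indep_var_nn_integral_mult:
  assumes ind: "indep_var S X T Y" and f [measurable]: "f \<in> borel_measurable S" and h [measurable]: "h \<in> borel_measurable T"
  shows "(\<integral>\<^sup>+\<omega>. f (X \<omega>) * h (Y \<omega>) \<partial>M) = (\<integral>\<^sup>+\<omega>. f (X \<omega>) \<partial>M) * (\<integral>\<^sup>+\<omega>. h (Y \<omega>) \<partial>M)"
proof -
  have [measurable]: "X \<in> measurable M S" "Y \<in> measurable M T"
    and eq: "distr M S X \<Otimes>\<^sub>M distr M T Y = distr M (S \<Otimes>\<^sub>M T) (\<lambda>\<omega>. (X \<omega>, Y \<omega>))"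
    using ind by (auto simp: indep_var_distribution_eq)
  interpret X: prob_space "distr M S X" by (rule prob_space_distr) simp
  interpret Y: prob_space "distr M T Y" by (rule prob_space_distr) simp
  have "(\<integral>\<^sup>+\<omega>. f (X \<omega>) * h (Y \<omega>) \<partial>M) = (\<integral>\<^sup>+z. f (fst z) * h (snd z) \<partial>distr M (S \<Otimes>\<^sub>M T) (\<lambda>\<omega>. (X \<omega>, Y \<omega>)))"
    by (subst nn_integral_distr) auto
  also have "\<dots> = (\<integral>\<^sup>+x. \<integral>\<^sup>+y. f x * h y \<partial>distr M T Y \<partial>distr M S X)"
    unfolding eq[symmetric] by (subst Y.nn_integral_fst[symmetric]) auto
  also have "\<dots> = (\<integral>\<^sup>+x. f x \<partial>distr M S X) * (\<integral>\<^sup>+y. h y \<partial>distr M T Y)"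
    by (simp add: nn_integral_cmult nn_integral_multc)
  finally show ?thesis by (simp add: nn_integral_distr)
qed

text \<open>
  By convexity, \<open>exp z - 1 \<le> (exp (K z) - 1) / K\<close>. For a small random \<open>y\<close> the exponential moments at
  \<open>K\<close> and \<open>- K\<close> are bounded, and the factor \<open>1 / K\<close> makes the expectation small.
\<close>

lemma abs_exp_minus_one_le:
  assumes K: "K \<ge> (1 :: real)"
  shows "\<bar>exp y - 1\<bar> \<le> (exp (K * y) + exp (- K * y)) / K"
proof -
  have conv: "exp z - 1 \<le> exp (K * z) / K" for z :: real
  proof -
    have "exp (1 / K * (K * z) + (1 - 1 / K) * 0) \<le> 1 / K * exp (K * z) + (1 - 1 / K) * exp 0"
      using convex_onD[OF exp_convex, of "1 - 1 / K" "K * z" 0] K by simp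
    moreover have "1 / K > 0" using K by simp
    ultimately have "exp z \<le> exp (K * z) / K + (1 - 1 / K)" using K by simp
    with \<open>1 / K > 0\<close> show ?thesis by linarith
  qed
  have "0 \<le> (exp (y / 2) - exp (- (y / 2)))\<^sup>2" by simp
  also have "\<dots> = exp y + exp (- y) - 2"
    by (simp add: power2_eq_square algebra_simps flip: exp_add)
  finally have "1 - exp y \<le> exp (- y) - 1" by simp
  then have "1 - exp y \<le> exp (- K * y) / K" using conv[of "- y"] by simp
  moreover have "exp (K * y) / K > 0" "exp (- K * y) / K > 0" using K by auto
  ultimately show ?thesis using conv[of y] unfolding add_divide_distrib by linarith
qed

lemma (in prob_space) nn_integral_abs_exp_minus_one:
  assumes [measurable]: "Y \<in> borel_measurable M" and K: "K \<ge> 1"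
    and mgf: "\<And>t. (\<integral>\<^sup>+\<omega>. ennreal (exp (t * Y \<omega>)) \<partial>M) \<le> ennreal (exp (t\<^sup>2 * v / 2))"
  shows "(\<integral>\<^sup>+\<omega>. ennreal \<bar>exp (Y \<omega>) - 1\<bar> \<partial>M) \<le> ennreal (2 * exp (K\<^sup>2 * v / 2) / K)"
proof -
  have "(\<integral>\<^sup>+\<omega>. ennreal \<bar>exp (Y \<omega>) - 1\<bar> \<partial>M)
     \<le> (\<integral>\<^sup>+\<omega>. ennreal (1 / K) * (ennreal (exp (K * Y \<omega>)) + ennreal (exp (- K * Y \<omega>))) \<partial>M)"
    using abs_exp_minus_one_le[OF K] K
    by (intro nn_integral_mono) (auto simp flip: ennreal_plus ennreal_mult intro!: ennreal_leI)
  also have "\<dots> = ennreal (1 / K) * ((\<integral>\<^sup>+\<omega>. ennreal (exp (K * Y \<omega>)) \<partial>M) + (\<integral>\<^sup>+\<omega>. ennreal (exp (- K * Y \<omega>)) \<partial>M))"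
    by (subst nn_integral_cmult, simp, subst nn_integral_add) simp_all
  also have "\<dots> \<le> ennreal (1 / K) * (ennreal (exp (K\<^sup>2 * v / 2)) + ennreal (exp (K\<^sup>2 * v / 2)))"
    using mgf[of K] mgf[of "- K"] by (intro mult_left_mono add_mono) auto
  also have "\<dots> = ennreal (2 * exp (K\<^sup>2 * v / 2) / K)"
    using K by (simp flip: ennreal_plus ennreal_mult)
  finally show ?thesis .
qed

lemma measurable_tilt:
  assumes "sigma_finite_measure Q" and [measurable]: "(\<lambda>z. h (fst z) (snd z)) \<in> borel_measurable (X \<Otimes>\<^sub>M Q)"
  shows "(\<lambda>z. tilt Q (h (fst z)) (snd z)) \<in> borel_measurable (X \<Otimes>\<^sub>M Q)"
proof -
  interpret sigma_finite_measure Q by fact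
  have [measurable]: "(\<lambda>x. partition_fn Q (h x)) \<in> borel_measurable X"
    unfolding partition_fn_def by (rule borel_measurable_lebesgue_integral) (simp add: case_prod_beta)
  show ?thesis unfolding tilt_def by measurable
qed

lemma (in prob_space) nn_integral_tilt_le: 
  assumes [measurable]: "h \<in> borel_measurable M"
  shows "(\<integral>\<^sup>+x. ennreal (tilt M h x) \<partial>M) \<le> 1"
proof (cases "integrable M (\<lambda>x. exp (h x))")
  case True
  then show ?thesis using tilt_density[OF True] tilt_nonneg by (subst nn_integral_eq_integral) auto
next
  case False
  then show ?thesis by (simp add: tilt_def partition_fn_def not_integrable_integral_eq)
qed

lemma gibbs_eq_density_tilt: "gibbs Q \<gamma> N b g = density Q (tilt Q (\<lambda>\<sigma>. b * hamiltonian \<gamma> N g \<sigma>))"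
  by (simp add: gibbs_def tilt_def[abs_def] partition_fn_def)

text \<open>
  The two steps of the argument for a fixed dimension \<open>N\<close>: rescaling of \<open>H\<close>, with the parameter
  \<open>t = 1 / K\<close>, contributes the first two terms of the bound, and the independent noise contributes the
  last one. The distance is bounded by a function \<open>R\<close> that is integrable by construction, because the
  distances of the measures are extrema over uncountable families, whose measurability in the disorder
  is not evident.
\<close>

lemma expected_L1_distance:
  fixes \<gamma> :: "nat \<Rightarrow> real"
  assumes gamma_nonneg: "\<And>p. p \<ge> 1 \<Longrightarrow> \<gamma> p \<ge> 0" and xi_radius: "conv_radius (\<lambda>p. (\<gamma> p)\<^sup>2) > 1"
    and Q: "prob_space Q" and setsQ: "sets Q = sets (Rn N)" and N: "N \<ge> 1"
    and sphere: "AE \<sigma> in Q. sqnorm N \<sigma> = N"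
    and gaussian: "iid_gaussian_pair N P G W"
    and b: "0 \<le> b" "b \<le> B" and e: "0 \<le> e" "e \<le> 1" and K: "K \<ge> 1"
  defines "\<xi> \<equiv> suminf (spin_var \<gamma>)"
  defines "p \<equiv> \<lambda>\<omega> \<sigma>. b * hamiltonian \<gamma> N (G \<omega>) \<sigma>"
  defines "q \<equiv> \<lambda>\<omega> \<sigma>. b * hamiltonian \<gamma> N (correlate e (G \<omega>) (W \<omega>)) \<sigma>"
  shows "\<exists>R. integrable P R \<and>
      (\<integral>\<omega>. R \<omega> \<partial>P) \<le> 2 / K + e * N * K * (B\<^sup>2 * \<xi> + B * exp (\<xi> / 2)) + 4 * exp (K\<^sup>2 * (e * N) * B\<^sup>2 * \<xi>) / K \<and>
      (AE \<omega> in P. integrable Q (\<lambda>\<sigma>. exp (p \<omega> \<sigma>)) \<and> integrable Q (\<lambda>\<sigma>. exp (q \<omega> \<sigma>)) \<and>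
         (\<integral>\<sigma>. \<bar>tilt Q (p \<omega>) \<sigma> - tilt Q (q \<omega>) \<sigma>\<bar> \<partial>Q) \<le> R \<omega>)"
proof -
  note [measurable_cong] = setsQ
  have spQ: "space Q = space (Rn N)" by (rule sets_eq_imp_space_eq[OF setsQ])
  interpret Q: prob_space Q by fact
  define I where "I = (SIGMA p:{1..}. multi_indices N p)"
  define X where "X = (\<lambda>(first, p, I) \<omega>. if first then G \<omega> p I else W \<omega> p I)"
  have P: "prob_space P" and indep: "prob_space.indep_vars P (\<lambda>_. borel) X (UNIV \<times> I)"
    and nG: "\<And>p I. p \<ge> 1 \<Longrightarrow> I \<in> multi_indices N p \<Longrightarrow> distributed P lborel (\<lambda>\<omega>. G \<omega> p I) (\<lambda>x. ennreal (std_normal_density x))"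
    and nW: "\<And>p I. p \<ge> 1 \<Longrightarrow> I \<in> multi_indices N p \<Longrightarrow> distributed P lborel (\<lambda>\<omega>. W \<omega> p I) (\<lambda>x. ennreal (std_normal_density x))"
    using gaussian unfolding iid_gaussian_pair_def X_def I_def by auto
  interpret P: prob_space P by fact
  interpret PQ: pair_prob_space P Q ..
  interpret G: gaussian_disorder P N G X True
  proof
    show "P.indep_vars (\<lambda>_. borel) X ({True} \<times> (SIGMA p:{1..}. multi_indices N p))"
      by (rule P.indep_vars_subset[OF indep]) (auto simp: I_def)
  qed (use N nG in \<open>simp_all add: X_def\<close>)
  interpret W: gaussian_disorder P N W X False
  proof
    show "P.indep_vars (\<lambda>_. borel) X ({False} \<times> (SIGMA p:{1..}. multi_indices N p))"
      by (rule P.indep_vars_subset[OF indep]) (auto simp: I_def)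
  qed (use N nW in \<open>simp_all add: X_def\<close>)
  define H where "H \<omega> = hamiltonian \<gamma> N (G \<omega>)" for \<omega>
  define H' where "H' \<omega> = hamiltonian \<gamma> N (W \<omega>)" for \<omega>
  have cong: "borel_measurable (Y \<Otimes>\<^sub>M Q) = borel_measurable (Y \<Otimes>\<^sub>M Rn N)" for Y :: "'z measure"
    by (intro measurable_cong_sets sets_pair_measure_cong setsQ) auto
  have Hm [measurable]: "(\<lambda>z. H (fst z) (snd z)) \<in> borel_measurable (P \<Otimes>\<^sub>M Q)"
    "(\<lambda>z. H' (fst z) (snd z)) \<in> borel_measurable (P \<Otimes>\<^sub>M Q)"
    unfolding H_def H'_def cong by measurable
  have Hm2 [measurable]: "H \<omega> \<in> borel_measurable Q" "H' \<omega> \<in> borel_measurable Q" for \<omega>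
    unfolding H_def H'_def by measurable
  have Hm1: "(\<lambda>\<omega>. H \<omega> \<sigma>) \<in> borel_measurable P" "(\<lambda>\<omega>. H' \<omega> \<sigma>) \<in> borel_measurable P" if "\<sigma> \<in> space Q" for \<sigma>
    using measurable_compose[OF measurable_Pair2'[OF that] Hm(1)] measurable_compose[OF measurable_Pair2'[OF that] Hm(2)] by auto
  have \<xi>: "\<xi> \<ge> 0" unfolding \<xi>_def
    by (intro suminf_nonneg summable_coefficients gamma_nonneg xi_radius) (auto simp: spin_var_def)
  have good: "AE \<sigma> in Q. sqnorm N \<sigma> = N \<and> \<sigma> \<in> space (Rn N)"
    using sphere AE_space by eventually_elim (simp add: spQ)
  have mgf: "(\<integral>\<^sup>+\<sigma>. \<integral>\<^sup>+\<omega>. ennreal (exp (t * H \<omega> \<sigma>)) \<partial>P \<partial>Q) \<le> ennreal (exp (t\<^sup>2 * N * \<xi> / 2))" for t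
  proof -
    have "(\<integral>\<^sup>+\<sigma>. \<integral>\<^sup>+\<omega>. ennreal (exp (t * H \<omega> \<sigma>)) \<partial>P \<partial>Q) \<le> (\<integral>\<^sup>+\<sigma>. ennreal (exp (t\<^sup>2 * N * \<xi> / 2)) \<partial>Q)"
    proof (rule nn_integral_mono_AE)
      show "AE \<sigma> in Q. (\<integral>\<^sup>+\<omega>. ennreal (exp (t * H \<omega> \<sigma>)) \<partial>P) \<le> ennreal (exp (t\<^sup>2 * N * \<xi> / 2))"
        using good by eventually_elim (auto simp: H_def \<xi>_def intro!: G.hamiltonian_mgf gamma_nonneg xi_radius)
    qed
    then show ?thesis by (simp add: Q.emeasure_space_1)
  qed
  have Hexp: "AE \<omega> in P. integrable Q (\<lambda>\<sigma>. exp (t * H \<omega> \<sigma>))"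
    "integrable P (\<lambda>\<omega>. partition_fn Q (\<lambda>\<sigma>. t * H \<omega> \<sigma>))"
    "(\<integral>\<omega>. partition_fn Q (\<lambda>\<sigma>. t * H \<omega> \<sigma>) \<partial>P) \<le> exp (t\<^sup>2 * N * \<xi> / 2)" for t
    unfolding partition_fn_def
    by (rule section_integrals_bound[OF P Q, where c="exp (t\<^sup>2 * N * \<xi> / 2)"]; (simp add: mgf; fail)?; measurable)+

  define s where "s = sqrt (2 * e - e\<^sup>2)"
  have s2: "s\<^sup>2 \<le> 2 * e" using e mult_left_le[of e e] by (simp add: s_def power2_eq_square)
  define r where "r \<omega> = tilt Q (\<lambda>\<sigma>. (1 - e) * (b * H \<omega> \<sigma>))" for \<omega>
  define Y where "Y \<omega> \<sigma> = s * b * H' \<omega> \<sigma>" for \<omega> \<sigma>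
  define \<delta> where "\<delta> = 2 * exp (K\<^sup>2 * (s\<^sup>2 * b\<^sup>2 * N * \<xi>) / 2) / K"
  have \<delta>: "\<delta> \<ge> 0" using K by (simp add: \<delta>_def)
  have rm [measurable]: "(\<lambda>z. r (fst z) (snd z)) \<in> borel_measurable (P \<Otimes>\<^sub>M Q)"
    unfolding r_def
    by (rule measurable_tilt[OF Q.sigma_finite_measure_axioms, of "\<lambda>\<omega> \<sigma>. (1 - e) * (b * H \<omega> \<sigma>)"]) measurable
  have rm1: "(\<lambda>\<omega>. r \<omega> \<sigma>) \<in> borel_measurable P" if "\<sigma> \<in> space Q" for \<sigma>
    using measurable_compose[OF measurable_Pair2'[OF that] rm] by auto
  have r0: "r \<omega> \<sigma> \<ge> 0" for \<omega> \<sigma> unfolding r_def by (rule Q.tilt_nonneg)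
  \<comment> \<open>For a fixed point, the intermediate density is a function of the disorder and the noise a function of its copy.\<close>
  have independence: "(\<integral>\<^sup>+\<omega>. ennreal (r \<omega> \<sigma>) * ennreal \<bar>exp (Y \<omega> \<sigma>) - 1\<bar> \<partial>P)
     = (\<integral>\<^sup>+\<omega>. ennreal (r \<omega> \<sigma>) \<partial>P) * (\<integral>\<^sup>+\<omega>. ennreal \<bar>exp (Y \<omega> \<sigma>) - 1\<bar> \<partial>P)" if \<sigma>: "\<sigma> \<in> space Q" for \<sigma>
  proof -
    define S where "S c = PiM ({c} \<times> I) (\<lambda>_. borel :: real measure)" for c :: bool
    define Z where "Z c \<omega> = restrict (\<lambda>i. X i \<omega>) ({c} \<times> I)" for c \<omega>
    define h where "h c x = hamiltonian \<gamma> N (\<lambda>p J. x (c, p, J))" for c and x :: "bool \<times> nat \<times> nat list \<Rightarrow> real"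
    have ind: "P.indep_var (S True) (Z True) (S False) (Z False)"
      unfolding S_def Z_def by (rule P.indep_var_restrict[OF indep]) auto
    have hm [measurable]: "(\<lambda>z. h c (fst z) (snd z)) \<in> borel_measurable (S c \<Otimes>\<^sub>M Q)" for c
      unfolding h_def cong by (rule measurable_hamiltonian) (auto simp: S_def I_def intro!: measurable_component_singleton)
    have [measurable]: "(\<lambda>x. h False x \<sigma>) \<in> borel_measurable (S False)"
      using measurable_compose[OF measurable_Pair2'[OF \<sigma>] hm] by simp
    have "(\<lambda>z. tilt Q (\<lambda>\<sigma>. (1 - e) * (b * h True (fst z) \<sigma>)) (snd z)) \<in> borel_measurable (S True \<Otimes>\<^sub>M Q)"
      by (rule measurable_tilt[OF Q.sigma_finite_measure_axioms, of "\<lambda>x \<sigma>. (1 - e) * (b * h True x \<sigma>)"]) measurable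
    from measurable_compose[OF measurable_Pair2'[OF \<sigma>] this]
    have [measurable]: "(\<lambda>x. tilt Q (\<lambda>\<sigma>. (1 - e) * (b * h True x \<sigma>)) \<sigma>) \<in> borel_measurable (S True)" by simp
    have HZ: "H \<omega> = h True (Z True \<omega>)" "H' \<omega> = h False (Z False \<omega>)" for \<omega>
      unfolding H_def H'_def h_def by (auto intro!: hamiltonian_cong simp: Z_def X_def I_def)
    show ?thesis unfolding r_def Y_def HZ
      by (rule P.indep_var_nn_integral_mult[OF ind, of "\<lambda>x. ennreal (tilt Q (\<lambda>\<sigma>. (1 - e) * (b * h True x \<sigma>)) \<sigma>)"
         "\<lambda>x. ennreal \<bar>exp (s * b * h False x \<sigma>) - 1\<bar>"]) measurable
  qed
  have "(\<integral>\<^sup>+\<sigma>. \<integral>\<^sup>+\<omega>. ennreal (r \<omega> \<sigma> * \<bar>exp (Y \<omega> \<sigma>) - 1\<bar>) \<partial>P \<partial>Q) \<le> (\<integral>\<^sup>+\<sigma>. (\<integral>\<^sup>+\<omega>. ennreal (r \<omega> \<sigma>) \<partial>P) * ennreal \<delta> \<partial>Q)"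
  proof (rule nn_integral_mono_AE)
    show "AE \<sigma> in Q. (\<integral>\<^sup>+\<omega>. ennreal (r \<omega> \<sigma> * \<bar>exp (Y \<omega> \<sigma>) - 1\<bar>) \<partial>P) \<le> (\<integral>\<^sup>+\<omega>. ennreal (r \<omega> \<sigma>) \<partial>P) * ennreal \<delta>"
      using good
    proof eventually_elim
      case (elim \<sigma>)
      then have \<sigma>: "sqnorm N \<sigma> = N" "\<sigma> \<in> space (Rn N)" "\<sigma> \<in> space Q" by (auto simp: spQ)
      note [measurable] = Hm1[OF \<sigma>(3)]
      have "(\<integral>\<^sup>+\<omega>. ennreal \<bar>exp (Y \<omega> \<sigma>) - 1\<bar> \<partial>P) \<le> ennreal \<delta>"
        unfolding \<delta>_def
      proof (rule P.nn_integral_abs_exp_minus_one[OF _ K])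
        show "(\<integral>\<^sup>+\<omega>. ennreal (exp (t * Y \<omega> \<sigma>)) \<partial>P) \<le> ennreal (exp (t\<^sup>2 * (s\<^sup>2 * b\<^sup>2 * N * \<xi>) / 2))" for t
          using W.hamiltonian_mgf[OF gamma_nonneg xi_radius \<sigma>(1,2), of "t * s * b"]
          by (simp add: Y_def H'_def \<xi>_def power_mult_distrib mult_ac)
      qed (simp add: Y_def)
      then show ?case using r0 by (simp add: ennreal_mult independence[OF \<sigma>(3)] mult_left_mono)
    qed
  qed
  also have "\<dots> = (\<integral>\<^sup>+\<sigma>. (\<integral>\<^sup>+\<omega>. ennreal (r \<omega> \<sigma>) \<partial>P) \<partial>Q) * ennreal \<delta>"
  proof (rule nn_integral_multc, rule P.borel_measurable_nn_integral)
    have "(\<lambda>z. r (snd z) (fst z)) \<in> borel_measurable (Q \<Otimes>\<^sub>M P)"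
      using measurable_compose[OF measurable_Pair[OF measurable_snd measurable_fst] rm] by simp
    then show "(\<lambda>(\<sigma>, \<omega>). ennreal (r \<omega> \<sigma>)) \<in> borel_measurable (Q \<Otimes>\<^sub>M P)"
      by (simp add: case_prod_beta)
  qed
  also have "(\<integral>\<^sup>+\<sigma>. (\<integral>\<^sup>+\<omega>. ennreal (r \<omega> \<sigma>) \<partial>P) \<partial>Q) = (\<integral>\<^sup>+\<omega>. (\<integral>\<^sup>+\<sigma>. ennreal (r \<omega> \<sigma>) \<partial>Q) \<partial>P)"
    by (rule PQ.Fubini') (simp add: case_prod_beta)
  also have "\<dots> * ennreal \<delta> \<le> (\<integral>\<^sup>+\<omega>. 1 \<partial>P) * ennreal \<delta>"
    unfolding r_def by (intro mult_right_mono nn_integral_mono Q.nn_integral_tilt_le) auto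
  also have "\<dots> = ennreal \<delta>" by (simp add: P.emeasure_space_1)
  finally have noise_moment: "(\<integral>\<^sup>+\<sigma>. \<integral>\<^sup>+\<omega>. ennreal (r \<omega> \<sigma> * \<bar>exp (Y \<omega> \<sigma>) - 1\<bar>) \<partial>P \<partial>Q) \<le> ennreal \<delta>" .
  have Ym [measurable]: "(\<lambda>z. r (fst z) (snd z) * \<bar>exp (Y (fst z) (snd z)) - 1\<bar>) \<in> borel_measurable (P \<Otimes>\<^sub>M Q)"
    unfolding Y_def by measurable
  note noise_sections = section_integrals_bound[OF P Q Ym _ noise_moment \<delta>]

  \<comment> \<open>The logarithms in the rescaling bound are linearised: ln z is at most z / c - 1 + ln c, where c
    bounds the expectation of z = Z2, and the lower bound on the logarithm of the partition function
    uses the moment at - 1 / N, whose expectation is bounded uniformly in N.\<close>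
  define Z2 where "Z2 \<omega> = partition_fn Q (\<lambda>\<sigma>. 2 * b * H \<omega> \<sigma>)" for \<omega>
  define Zm where "Zm \<omega> = partition_fn Q (\<lambda>\<sigma>. (- 1 / N) * H \<omega> \<sigma>)" for \<omega>
  define c where "c = exp ((2 * b)\<^sup>2 * N * \<xi> / 2)"
  define drift_term where "drift_term \<omega> = 2 / K + e * K / 2 * (Z2 \<omega> / c - 1 + ln c + 2 * (b * N * Zm \<omega>))" for \<omega>
  define noise_term where "noise_term \<omega> = (\<integral>\<sigma>. r \<omega> \<sigma> * \<bar>exp (Y \<omega> \<sigma>) - 1\<bar> \<partial>Q)" for \<omega>
  define R where "R \<omega> = drift_term \<omega> + 2 * noise_term \<omega>" for \<omega>
  have c: "c > 0" by (simp add: c_def)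
  have iZ2: "integrable P Z2" "(\<integral>\<omega>. Z2 \<omega> \<partial>P) \<le> c" unfolding Z2_def[abs_def] c_def by (rule Hexp)+
  have iZm: "integrable P Zm" "(\<integral>\<omega>. Zm \<omega> \<partial>P) \<le> exp ((- 1 / N)\<^sup>2 * N * \<xi> / 2)" unfolding Zm_def[abs_def] by (rule Hexp)+
  have i_noise: "integrable P noise_term" "(\<integral>\<omega>. noise_term \<omega> \<partial>P) \<le> \<delta>" unfolding noise_term_def[abs_def] using noise_sections(2,3) r0 by auto
  have iR: "integrable P R" unfolding R_def[abs_def] drift_term_def using iZ2 iZm i_noise by auto
  have EZm: "(\<integral>\<omega>. Zm \<omega> \<partial>P) \<le> exp (\<xi> / 2)"
  proof -
    have "(- 1 / real N)\<^sup>2 * N = 1 / N" using N by (simp add: power2_eq_square)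
    moreover have "1 / real N * \<xi> \<le> 1 * \<xi>" using N \<xi> by (intro mult_right_mono) auto
    ultimately have "exp ((- 1 / N)\<^sup>2 * N * \<xi> / 2) \<le> exp (\<xi> / 2)" by simp
    then show ?thesis using iZm(2) by linarith
  qed
  have "(\<integral>\<omega>. R \<omega> \<partial>P) = 2 / K + e * K / 2 * ((\<integral>\<omega>. Z2 \<omega> \<partial>P) / c - 1 + ln c + 2 * (b * N * (\<integral>\<omega>. Zm \<omega> \<partial>P))) + 2 * (\<integral>\<omega>. noise_term \<omega> \<partial>P)"
    unfolding R_def[abs_def] drift_term_def using iZ2(1) iZm(1) i_noise(1) by (simp add: P.prob_space)
  also have "\<dots> \<le> 2 / K + e * K / 2 * (1 - 1 + ln c + 2 * (b * N * exp (\<xi> / 2))) + 2 * \<delta>"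
    using e K iZ2(2) c EZm i_noise(2) b by (intro add_mono mult_left_mono diff_mono) auto
  also have "\<dots> = 2 / K + e * N * K * (b\<^sup>2 * \<xi> + b * exp (\<xi> / 2)) + 2 * \<delta>"
    by (simp add: c_def power_mult_distrib algebra_simps)
  also have "\<dots> \<le> 2 / K + e * N * K * (B\<^sup>2 * \<xi> + B * exp (\<xi> / 2)) + 2 * \<delta>"
    using e K b \<xi> by (intro add_mono mult_left_mono mult_right_mono power_mono) auto
  also have "2 * \<delta> \<le> 4 * exp (K\<^sup>2 * (e * N) * B\<^sup>2 * \<xi>) / K"
  proof -
    have "s\<^sup>2 * b\<^sup>2 * N * \<xi> \<le> (2 * e) * B\<^sup>2 * N * \<xi>"
      using s2 b e \<xi> by (intro mult_right_mono mult_mono power_mono) auto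
    then have "K\<^sup>2 * (s\<^sup>2 * b\<^sup>2 * N * \<xi>) \<le> K\<^sup>2 * ((2 * e) * B\<^sup>2 * N * \<xi>)" by (intro mult_left_mono) auto
    then have "K\<^sup>2 * (s\<^sup>2 * b\<^sup>2 * N * \<xi>) / 2 \<le> K\<^sup>2 * (e * N) * B\<^sup>2 * \<xi>" by (simp add: mult_ac)
    then show ?thesis unfolding \<delta>_def using K by (simp add: divide_right_mono)
  qed
  finally have ER: "(\<integral>\<omega>. R \<omega> \<partial>P) \<le> 2 / K + e * N * K * (B\<^sup>2 * \<xi> + B * exp (\<xi> / 2)) + 4 * exp (K\<^sup>2 * (e * N) * B\<^sup>2 * \<xi>) / K" by simp

  have "AE \<omega> in P. AE \<sigma> in Q. (\<Sum>p. ennreal \<bar>spin_term \<gamma> N (G \<omega>) \<sigma> p\<bar>) \<noteq> \<top> \<and> (\<Sum>p. ennreal \<bar>spin_term \<gamma> N (W \<omega>) \<sigma> p\<bar>) \<noteq> \<top>"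
  proof (subst PQ.AE_commute)
    have [measurable]: "(\<lambda>z. spin_term \<gamma> N (G (fst z)) (snd z) p) \<in> borel_measurable (P \<Otimes>\<^sub>M Q)"
      "(\<lambda>z. spin_term \<gamma> N (W (fst z)) (snd z) p) \<in> borel_measurable (P \<Otimes>\<^sub>M Q)" for p
      unfolding cong by measurable
    show "{z \<in> space (P \<Otimes>\<^sub>M Q). (\<Sum>p. ennreal \<bar>spin_term \<gamma> N (G (fst z)) (snd z) p\<bar>) \<noteq> \<top> \<and>
      (\<Sum>p. ennreal \<bar>spin_term \<gamma> N (W (fst z)) (snd z) p\<bar>) \<noteq> \<top>} \<in> sets (P \<Otimes>\<^sub>M Q)" by measurable
    show "AE \<sigma> in Q. AE \<omega> in P. (\<Sum>p. ennreal \<bar>spin_term \<gamma> N (G \<omega>) \<sigma> p\<bar>) \<noteq> \<top> \<and> (\<Sum>p. ennreal \<bar>spin_term \<gamma> N (W \<omega>) \<sigma> p\<bar>) \<noteq> \<top>"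
      using good
    proof eventually_elim
      case (elim \<sigma>)
      then show ?case
        by (intro AE_conjI G.AE_spin_series_finite W.AE_spin_series_finite gamma_nonneg xi_radius) auto
    qed
  qed
  then have lin: "AE \<omega> in P. AE \<sigma> in Q. q \<omega> \<sigma> = (1 - e) * (b * H \<omega> \<sigma>) + Y \<omega> \<sigma>"
  proof eventually_elim
    case (elim \<omega>)
    then show ?case
    proof eventually_elim
      case (elim \<sigma>)
      then have eq: "hamiltonian \<gamma> N (correlate e (G \<omega>) (W \<omega>)) \<sigma> = (1 - e) * H \<omega> \<sigma> + s * H' \<omega> \<sigma>"
        unfolding H_def H'_def s_def by (intro hamiltonian_correlate summable_spin_term) auto
      show ?case unfolding q_def Y_def eq by (simp add: algebra_simps)
    qed
  qed
  have "AE \<omega> in P. integrable Q (\<lambda>\<sigma>. exp (p \<omega> \<sigma>)) \<and> integrable Q (\<lambda>\<sigma>. exp (q \<omega> \<sigma>)) \<and>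
         (\<integral>\<sigma>. \<bar>tilt Q (p \<omega>) \<sigma> - tilt Q (q \<omega>) \<sigma>\<bar> \<partial>Q) \<le> R \<omega>"
    using lin Hexp(1)[of b] Hexp(1)[of "2 * b"] Hexp(1)[of "- 1 / N"] noise_sections(1)[OF mult_nonneg_nonneg[OF r0 abs_ge_zero]]
  proof eventually_elim
    case (elim \<omega>)
    note lin = elim(1) and i1 = elim(2) and i2 = elim(3) and im = elim(4) and iY = elim(5)
    have p: "p \<omega> = (\<lambda>\<sigma>. b * H \<omega> \<sigma>)" by (simp add: p_def H_def)
    have [measurable]: "q \<omega> \<in> borel_measurable Q" "Y \<omega> \<in> borel_measurable Q" unfolding q_def Y_def by measurable
    have [measurable]: "p \<omega> \<in> borel_measurable Q" unfolding p by measurable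
    have i2': "integrable Q (\<lambda>\<sigma>. exp (2 * (b * H \<omega> \<sigma>)))" using i2 by (simp add: mult.assoc)
    note T1 = Q.tilt_rescaling[OF i1 i2' _ e, where t="1 / K"]
    have ir: "integrable Q (\<lambda>\<sigma>. exp ((1 - e) * (b * H \<omega> \<sigma>)))" using T1(1) K by simp
    note T2 = Q.tilt_perturbation[OF ir, of "Y \<omega>", folded r_def[of \<omega>]]
    define q' where "q' \<sigma> = (1 - e) * (b * H \<omega> \<sigma>) + Y \<omega> \<sigma>" for \<sigma>
    have [measurable]: "q' \<in> borel_measurable Q" unfolding q'_def by measurable
    have iq': "integrable Q (\<lambda>\<sigma>. exp (q' \<sigma>))" unfolding q'_def using T2(1) iY by simp
    have d2: "(\<integral>\<sigma>. \<bar>r \<omega> \<sigma> - tilt Q q' \<sigma>\<bar> \<partial>Q) \<le> 2 * noise_term \<omega>" unfolding q'_def noise_term_def using T2(2) iY by simp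
    have eq: "AE \<sigma> in Q. q \<omega> \<sigma> = q' \<sigma>" using lin by (simp add: q'_def)
    have iq: "integrable Q (\<lambda>\<sigma>. exp (q \<omega> \<sigma>))"
      by (subst integrable_cong_AE[where g="\<lambda>\<sigma>. exp (q' \<sigma>)"]) (use eq iq' in \<open>auto\<close>)
    have Zq: "partition_fn Q (q \<omega>) = partition_fn Q q'" unfolding partition_fn_def
      by (rule integral_cong_AE) (use eq in auto)
    have [measurable]: "tilt Q (q \<omega>) \<in> borel_measurable Q" "tilt Q (p \<omega>) \<in> borel_measurable Q" "tilt Q q' \<in> borel_measurable Q"
      unfolding tilt_def[abs_def] p by measurable
    have Dq: "(\<integral>\<sigma>. \<bar>tilt Q (p \<omega>) \<sigma> - tilt Q (q \<omega>) \<sigma>\<bar> \<partial>Q) = (\<integral>\<sigma>. \<bar>tilt Q (p \<omega>) \<sigma> - tilt Q q' \<sigma>\<bar> \<partial>Q)"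
      by (rule integral_cong_AE) (use eq in \<open>auto simp: tilt_def Zq\<close>)
    have it: "integrable Q (tilt Q (p \<omega>))" "integrable Q (tilt Q q')" "integrable Q (r \<omega>)"
      using Q.tilt_density(1)[OF i1] Q.tilt_density(1)[OF iq'] Q.tilt_density(1)[OF ir] by (auto simp: p r_def)
    have "(\<integral>\<sigma>. \<bar>tilt Q (p \<omega>) \<sigma> - tilt Q q' \<sigma>\<bar> \<partial>Q) \<le> (\<integral>\<sigma>. \<bar>tilt Q (p \<omega>) \<sigma> - r \<omega> \<sigma>\<bar> + \<bar>r \<omega> \<sigma> - tilt Q q' \<sigma>\<bar> \<partial>Q)"
      using it by (intro integral_mono) auto
    also have "\<dots> = (\<integral>\<sigma>. \<bar>tilt Q (p \<omega>) \<sigma> - r \<omega> \<sigma>\<bar> \<partial>Q) + (\<integral>\<sigma>. \<bar>r \<omega> \<sigma> - tilt Q q' \<sigma>\<bar> \<partial>Q)"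
      using it by (intro Bochner_Integration.integral_add) auto
    also have "\<dots> \<le> drift_term \<omega> + 2 * noise_term \<omega>"
    proof (intro add_mono d2)
      have "ln (Z2 \<omega> / c) \<le> Z2 \<omega> / c - 1" 
        using Q.partition_fn_pos[OF i2] c by (intro ln_le_minus_one) (simp add: Z2_def)
      then have up: "ln (Z2 \<omega>) \<le> Z2 \<omega> / c - 1 + ln c"
        using Q.partition_fn_pos[OF i2] c by (simp add: Z2_def ln_div)
      have low: "- ln (partition_fn Q (\<lambda>\<sigma>. b * H \<omega> \<sigma>)) \<le> b * N * Zm \<omega>"
        using Q.neg_log_partition_le[of "b * N" "\<lambda>\<sigma>. H \<omega> \<sigma> / N"] N b i1 im by (simp add: Zm_def)
      have "(\<integral>\<sigma>. \<bar>tilt Q (p \<omega>) \<sigma> - r \<omega> \<sigma>\<bar> \<partial>Q) \<le> 2 * (1 / K) + e / (2 * (1 / K)) * (ln (Z2 \<omega>) - 2 * ln (partition_fn Q (\<lambda>\<sigma>. b * H \<omega> \<sigma>)))"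
        using T1(2) K by (simp add: p r_def Z2_def mult.assoc)
      also have "\<dots> \<le> 2 * (1 / K) + e / (2 * (1 / K)) * (Z2 \<omega> / c - 1 + ln c + 2 * (b * N * Zm \<omega>))"
        using up low e K by (intro add_left_mono mult_left_mono) auto
      also have "\<dots> = drift_term \<omega>" by (simp add: drift_term_def)
      finally show "(\<integral>\<sigma>. \<bar>tilt Q (p \<omega>) \<sigma> - r \<omega> \<sigma>\<bar> \<partial>Q) \<le> drift_term \<omega>" .
    qed
    finally show ?case unfolding Dq R_def using i1 iq by (simp add: p)
  qed
  with iR ER show ?thesis by blast
qed

theorem proposition2p11:
  fixes \<gamma> \<beta> \<epsilon> :: "nat \<Rightarrow> real"
    and \<mu>0 :: "nat \<Rightarrow> (nat \<Rightarrow> real) measure"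
    and M :: "nat \<Rightarrow> 'a measure"
    and G W :: "nat \<Rightarrow> 'a \<Rightarrow> disorder"
  assumes gamma_nonneg: "\<And>p. p \<ge> 1 \<Longrightarrow> \<gamma> p \<ge> 0"
    and xi_radius: "conv_radius (\<lambda>p. (\<gamma> p)\<^sup>2) > 1"
    and reference: "\<mu>0 = sphere_uniform \<or> \<mu>0 = cube_uniform"
    and gaussian: "\<And>N. N \<ge> 1 \<Longrightarrow> iid_gaussian_pair N (M N) (G N) (W N)"
    and beta_nonneg: "\<And>N. N \<ge> 1 \<Longrightarrow> \<beta> N \<ge> 0"
    and beta_bounded: "bounded (\<beta> ` {1..})"
    and eps_range: "\<And>N. N \<ge> 1 \<Longrightarrow> \<epsilon> N \<in> {0..1}"
    and eps_small: "\<epsilon> \<in> o(\<lambda>N. 1 / real N)"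
  shows "((\<lambda>N. \<integral>\<omega>. tv_dist (gibbs (\<mu>0 N) \<gamma> N (\<beta> N) (G N \<omega>))
                      (gibbs (\<mu>0 N) \<gamma> N (\<beta> N) (correlate (\<epsilon> N) (G N \<omega>) (W N \<omega>))) \<partial>M N)
            \<longlonglongrightarrow> 0) \<and>
         ((\<lambda>N. \<integral>\<omega>. W2 N (gibbs (\<mu>0 N) \<gamma> N (\<beta> N) (G N \<omega>))
                      (gibbs (\<mu>0 N) \<gamma> N (\<beta> N) (correlate (\<epsilon> N) (G N \<omega>) (W N \<omega>))) \<partial>M N)
            \<longlonglongrightarrow> 0)"
proof -
  define \<mu> where "\<mu> N \<omega> = gibbs (\<mu>0 N) \<gamma> N (\<beta> N) (G N \<omega>)" for N \<omega>
  define \<nu> where "\<nu> N \<omega> = gibbs (\<mu>0 N) \<gamma> N (\<beta> N) (correlate (\<epsilon> N) (G N \<omega>) (W N \<omega>))" for N \<omega>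
  define \<xi> where "\<xi> = suminf (spin_var \<gamma>)"
  obtain B where B: "\<And>N. N \<ge> 1 \<Longrightarrow> \<beta> N \<le> B"
    using beta_bounded by (auto simp: bounded_iff abs_le_iff)
  define \<Phi> where "\<Phi> K x = 2 / K + x * K * (B\<^sup>2 * \<xi> + B * exp (\<xi> / 2)) + 4 * exp (K\<^sup>2 * x * B\<^sup>2 * \<xi>) / K" for K x
  have finite_N: "\<bar>\<integral>\<omega>. tv_dist (\<mu> N \<omega>) (\<nu> N \<omega>) \<partial>M N\<bar> \<le> \<Phi> K (\<epsilon> N * N) \<and>
      \<bar>\<integral>\<omega>. W2 N (\<mu> N \<omega>) (\<nu> N \<omega>) \<partial>M N\<bar> \<le> \<eta> + \<Phi> K (\<epsilon> N * N) / \<eta>"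
    if N: "N \<ge> 1" and K: "K \<ge> 1" and \<eta>: "\<eta> > 0" for N K \<eta>
  proof -
    define Q where "Q = \<mu>0 N"
    have Q: "prob_space Q" "sets Q = sets (Rn N)" "AE \<sigma> in Q. sqnorm N \<sigma> = N"
      using reference sphere_uniform_reference[OF N] cube_uniform_reference[of N] unfolding Q_def by blast+
    interpret Q: prob_space Q by (rule Q)
    interpret P: prob_space "M N" using gaussian[OF N] by (simp add: iid_gaussian_pair_def)
    define p where "p \<omega> \<sigma> = \<beta> N * hamiltonian \<gamma> N (G N \<omega>) \<sigma>" for \<omega> \<sigma>
    define q where "q \<omega> \<sigma> = \<beta> N * hamiltonian \<gamma> N (correlate (\<epsilon> N) (G N \<omega>) (W N \<omega>)) \<sigma>" for \<omega> \<sigma>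
    have gibbs: "\<mu> N \<omega> = density Q (tilt Q (p \<omega>))" "\<nu> N \<omega> = density Q (tilt Q (q \<omega>))" for \<omega>
      by (simp_all add: \<mu>_def \<nu>_def p_def[abs_def] q_def[abs_def] Q_def gibbs_eq_density_tilt)
    obtain R where R: "integrable (M N) R" "(\<integral>\<omega>. R \<omega> \<partial>M N) \<le> \<Phi> K (\<epsilon> N * N)"
      and good: "AE \<omega> in M N. integrable Q (\<lambda>\<sigma>. exp (p \<omega> \<sigma>)) \<and> integrable Q (\<lambda>\<sigma>. exp (q \<omega> \<sigma>)) \<and>
         (\<integral>\<sigma>. \<bar>tilt Q (p \<omega>) \<sigma> - tilt Q (q \<omega>) \<sigma>\<bar> \<partial>Q) \<le> R \<omega>"
      using expected_L1_distance[OF gamma_nonneg xi_radius Q(1,2) N Q(3) gaussian[OF N] beta_nonneg[OF N] B[OF N] _ _ K, of "\<epsilon> N"] eps_range[OF N]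
      unfolding p_def q_def \<Phi>_def \<xi>_def by auto
    have tv: "AE \<omega> in M N. tv_dist (\<mu> N \<omega>) (\<nu> N \<omega>) \<le> R \<omega>"
      using good
    proof eventually_elim
      case (elim \<omega>)
      then show ?case unfolding gibbs
        using tv_dist_density_le[of Q "tilt Q (p \<omega>)" "tilt Q (q \<omega>)"] by (auto simp: Q.tilt_density Q.tilt_nonneg)
    qed
    have tv0: "AE \<omega> in M N. 0 \<le> tv_dist (\<mu> N \<omega>) (\<nu> N \<omega>)"
      using good
    proof eventually_elim
      case (elim \<omega>)
      then show ?case unfolding gibbs
        by (intro tv_dist_density_nonneg) (auto simp: Q.tilt_density Q.tilt_nonneg)
    qed
    have R0: "AE \<omega> in M N. 0 \<le> R \<omega>" using tv tv0 by eventually_elim linarith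
    have w: "AE \<omega> in M N. W2 N (\<mu> N \<omega>) (\<nu> N \<omega>) \<le> \<eta> + R \<omega> / \<eta>"
      using good
    proof eventually_elim
      case (elim \<omega>)
      define D where "D = (\<integral>\<sigma>. \<bar>tilt Q (p \<omega>) \<sigma> - tilt Q (q \<omega>) \<sigma>\<bar> \<partial>Q)"
      have D: "0 \<le> D" "D \<le> R \<omega>" using elim by (auto simp: D_def)
      \<comment> \<open>The square root is replaced by a linear bound, whose expectation is available.\<close>
      have "W2 N (\<mu> N \<omega>) (\<nu> N \<omega>) \<le> sqrt (4 * D)" unfolding gibbs D_def
        using elim by (intro W2_density_le Q N) (auto simp: Q.tilt_density Q.tilt_nonneg)
      also have "\<dots> \<le> \<eta> + D / \<eta>"
      proof (rule real_le_lsqrt)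
        have "0 \<le> (\<eta> - D / \<eta>)\<^sup>2" by simp
        then show "4 * D \<le> (\<eta> + D / \<eta>)\<^sup>2" using \<eta> by (simp add: power2_diff power2_sum)
      qed (use D \<eta> in auto)
      also have "\<dots> \<le> \<eta> + R \<omega> / \<eta>" using D \<eta> by (simp add: divide_right_mono)
      finally show ?case .
    qed
    have "(\<integral>\<omega>. tv_dist (\<mu> N \<omega>) (\<nu> N \<omega>) \<partial>M N) \<le> (\<integral>\<omega>. R \<omega> \<partial>M N)"
      by (rule integral_mono_AE'[OF R(1) tv R0])
    moreover have "0 \<le> (\<integral>\<omega>. tv_dist (\<mu> N \<omega>) (\<nu> N \<omega>) \<partial>M N)" by (rule integral_nonneg_AE[OF tv0])
    moreover have "(\<integral>\<omega>. W2 N (\<mu> N \<omega>) (\<nu> N \<omega>) \<partial>M N) \<le> (\<integral>\<omega>. \<eta> + R \<omega> / \<eta> \<partial>M N)"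
    proof (rule integral_mono_AE'[OF _ w])
      show "AE \<omega> in M N. 0 \<le> \<eta> + R \<omega> / \<eta>" using R0 by eventually_elim (use \<eta> in auto)
    qed (use R(1) in auto)
    moreover have "(\<integral>\<omega>. \<eta> + R \<omega> / \<eta> \<partial>M N) = \<eta> + (\<integral>\<omega>. R \<omega> \<partial>M N) / \<eta>" using R(1) by (simp add: P.prob_space)
    moreover have "(\<integral>\<omega>. R \<omega> \<partial>M N) / \<eta> \<le> \<Phi> K (\<epsilon> N * N) / \<eta>" using R(2) \<eta> by (simp add: divide_right_mono)
    moreover have "0 \<le> (\<integral>\<omega>. W2 N (\<mu> N \<omega>) (\<nu> N \<omega>) \<partial>M N)" by (rule integral_nonneg_AE) (simp add: W2_def)
    ultimately show ?thesis using R(2) by auto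
  qed
  have "(\<lambda>N. \<epsilon> N / (1 / real N)) \<longlonglongrightarrow> 0" by (rule smalloD_tendsto[OF eps_small])
  then have x: "(\<lambda>N. \<epsilon> N * real N) \<longlonglongrightarrow> 0" by simp
  have \<Phi>_small: "\<exists>K\<ge>1. eventually (\<lambda>N. \<Phi> K (\<epsilon> N * real N) < \<eta>) sequentially" if \<eta>: "\<eta> > 0" for \<eta>
  proof -
    \<comment> \<open>At argument 0 the bound equals 6 / K.\<close>
    define K where "K = max 1 (7 / \<eta>)"
    have K: "K \<ge> 1" "6 / K < \<eta>"
    proof -
      have "7 / \<eta> \<le> K" by (simp add: K_def)
      then have "7 \<le> \<eta> * K" using \<eta> by (simp add: field_simps)
      moreover show "K \<ge> 1" by (simp add: K_def)
      ultimately show "6 / K < \<eta>" by (simp add: field_simps)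
    qed
    have "(\<lambda>N. \<Phi> K (\<epsilon> N * real N)) \<longlonglongrightarrow> 2 / K + 0 * K * (B\<^sup>2 * \<xi> + B * exp (\<xi> / 2)) + 4 * exp (K\<^sup>2 * 0 * B\<^sup>2 * \<xi>) / K"
      unfolding \<Phi>_def using K(1) by (intro tendsto_intros x) auto
    also have "2 / K + 0 * K * (B\<^sup>2 * \<xi> + B * exp (\<xi> / 2)) + 4 * exp (K\<^sup>2 * 0 * B\<^sup>2 * \<xi>) / K = 6 / K"
      by simp
    finally have "eventually (\<lambda>N. \<Phi> K (\<epsilon> N * real N) < \<eta>) sequentially"
      using K(2) by (rule order_tendstoD)
    with K(1) show ?thesis by blast
  qed
  have "(\<lambda>N. \<integral>\<omega>. tv_dist (\<mu> N \<omega>) (\<nu> N \<omega>) \<partial>M N) \<longlonglongrightarrow> 0"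
  proof (rule tendstoI)
    fix \<eta> :: real assume \<eta>: "\<eta> > 0"
    obtain K where K: "K \<ge> 1" "eventually (\<lambda>N. \<Phi> K (\<epsilon> N * real N) < \<eta>) sequentially" using \<Phi>_small[OF \<eta>] by blast
    show "eventually (\<lambda>N. dist (\<integral>\<omega>. tv_dist (\<mu> N \<omega>) (\<nu> N \<omega>) \<partial>M N) 0 < \<eta>) sequentially"
      using K(2) eventually_ge_at_top[of 1]
    proof eventually_elim
      case (elim N)
      then show ?case using finite_N[of N K \<eta>] K(1) \<eta> by simp
    qed
  qed
  moreover have "(\<lambda>N. \<integral>\<omega>. W2 N (\<mu> N \<omega>) (\<nu> N \<omega>) \<partial>M N) \<longlonglongrightarrow> 0"
  proof (rule tendstoI)
    fix \<eta> :: real assume \<eta>: "\<eta> > 0"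
    have "(\<eta> / 2)\<^sup>2 > 0" using \<eta> by simp
    then obtain K where K: "K \<ge> 1" "eventually (\<lambda>N. \<Phi> K (\<epsilon> N * real N) < (\<eta> / 2)\<^sup>2) sequentially" using \<Phi>_small by blast
    show "eventually (\<lambda>N. dist (\<integral>\<omega>. W2 N (\<mu> N \<omega>) (\<nu> N \<omega>) \<partial>M N) 0 < \<eta>) sequentially"
      using K(2) eventually_ge_at_top[of 1]
    proof eventually_elim
      case (elim N)
      have "\<Phi> K (\<epsilon> N * real N) / (\<eta> / 2) < \<eta> / 2"
        using elim(1) \<eta> by (simp add: power2_eq_square field_simps)
      then show ?case using finite_N[of N K "\<eta> / 2"] K(1) \<eta> elim(2) by simp
    qed
  qed
  ultimately show ?thesis unfolding \<mu>_def \<nu>_def by blast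
qed

end
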